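(* Let $\Delta^{n}$ be a ball centered at the origin $0$ in $\mathbb{C}^{n}$, let $F:\Delta^{n}\rightarrow\mathbb{C}^{n}$ be a holomorphic mapping such that $0$ is an isolated zero of $F$, and consider the system $$\dot{x}=\frac{dx}{dt}=F(x),\qquad x\in\Delta^{n},$$ with real time $t$. Suppose that the Jacobian matrix $F^{\prime}(0)$ has a nonzero pure imaginary eigenvalue $\omega i$ ($\omega\in\mathbb{R}$, $\omega\neq 0$) and that for any other eigenvalue $\lambda$ of $F^{\prime}(0)$ (eigenvalues being listed with algebraic multiplicity), $$\lambda/(\omega i)\neq 0,\pm 1,\pm 2,\dots .$$ Then there exists a complex analytic disk $D$ in $\Delta^{n}$ consisting of $0$ and periodic orbits of the system of the same period $\frac{2\pi}{|\omega|}$, and $D$ is unique in the sense that any analytic disk in $\Delta^{n}$ consisting of $0$ and periodic orbits of the system of the same period $\frac{2\pi}{|\omega|}$ coincides with $D$ in a neighborhood of $0$ in $\mathbb{C}^{n}$.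
   Context: Time $t$ is real. A periodic orbit is a nonconstant periodic orbit, and the period of a periodic orbit always means its least positive period. An analytic disk in $\Delta^{n}$ is the image of a holomorphic embedding of a disk in the complex plane into $\Delta^{n}$. "Consisting of $0$ and periodic orbits of the same period $\frac{2\pi}{|\omega|}$" means that the disk contains $0$ and that its complement of $\{0\}$ is a union of (entire) periodic orbits, each having least positive period $\frac{2\pi}{|\omega|}$. If $\lambda_{1}=\omega i,\lambda_{2},\dots,\lambda_{n}$ are the $n$ eigenvalues of $F^{\prime}(0)$ listed with algebraic multiplicity, "any other eigenvalue" refers to $\lambda_{2},\dots,\lambda_{n}$; in particular the hypothesis forces $\omega i$ to be a simple eigenvalue. *)

theory Defs
  imports "HOL-Complex_Analysis.Complex_Analysis"
begin

definition holomorphic_map_on ::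
    "(complex ^ 'n \<Rightarrow> complex ^ 'm) \<Rightarrow> (complex ^ 'n) set \<Rightarrow> bool" where
  "holomorphic_map_on F S \<longleftrightarrow>
     (\<forall>x\<in>S. \<exists>A :: complex ^ 'n ^ 'm. (F has_derivative (\<lambda>h. A *v h)) (at x within S))"

definition charpoly :: "'a::comm_ring_1 ^ 'n ^ 'n \<Rightarrow> 'a poly" where
  "charpoly A = det (mat [:0, 1:] - map_matrix (\<lambda>c. [:c:]) A)"

text \<open>The eigenvalues, each repeated according to its algebraic multiplicity.\<close>
definition eigenvalues :: "complex ^ 'n ^ 'n \<Rightarrow> complex multiset" where
  "eigenvalues A = proots (charpoly A)"

text \<open>Complete real-time solutions of \<open>x' = F x\<close> staying in \<open>S\<close>.\<close>
definition solution_in ::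
    "('a::real_normed_vector \<Rightarrow> 'a) \<Rightarrow> 'a set \<Rightarrow> (real \<Rightarrow> 'a) \<Rightarrow> bool" where
  "solution_in F S x \<longleftrightarrow>
     (\<forall>t. x t \<in> S \<and> (x has_vector_derivative F (x t)) (at t))"

definition least_period :: "(real \<Rightarrow> 'a) \<Rightarrow> real \<Rightarrow> bool" where
  "least_period x T \<longleftrightarrow>
     T > 0 \<and> (\<forall>t. x (t + T) = x t) \<and>
     (\<forall>T'. 0 < T' \<and> T' < T \<longrightarrow> \<not> (\<forall>t. x (t + T') = x t))"

text \<open>A constant function has no least positive period, so the orbits below are nonconstant.\<close>
definition periodic_orbit ::
    "('a::real_normed_vector \<Rightarrow> 'a) \<Rightarrow> 'a set \<Rightarrow> real \<Rightarrow> 'a set \<Rightarrow> bool" where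
  "periodic_orbit F S T C \<longleftrightarrow>
     (\<exists>x. solution_in F S x \<and> least_period x T \<and> C = range x)"

text \<open>An embedding is an immersion that is a homeomorphism onto its image.\<close>
definition holomorphic_disk_embedding ::
    "(complex \<Rightarrow> complex ^ 'n) \<Rightarrow> complex set \<Rightarrow> bool" where
  "holomorphic_disk_embedding \<phi> U \<longleftrightarrow>
     (\<forall>i. (\<lambda>z. \<phi> z $ i) holomorphic_on U) \<and>
     (\<forall>z\<in>U. \<exists>i. deriv (\<lambda>w. \<phi> w $ i) z \<noteq> 0) \<and>
     (\<exists>\<psi>. homeomorphism U (\<phi> ` U) \<phi> \<psi>)"

definition analytic_disk_in :: "(complex ^ 'n) set \<Rightarrow> (complex ^ 'n) set \<Rightarrow> bool" where
  "analytic_disk_in S D \<longleftrightarrow>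
     D \<subseteq> S \<and>
     (\<exists>\<phi> a r. r > 0 \<and> holomorphic_disk_embedding \<phi> (ball a r) \<and> D = \<phi> ` ball a r)"

definition consists_of_0_and_periodic_orbits ::
    "('a::real_normed_vector \<Rightarrow> 'a) \<Rightarrow> 'a set \<Rightarrow> real \<Rightarrow> 'a set \<Rightarrow> bool" where
  "consists_of_0_and_periodic_orbits F S T D \<longleftrightarrow>
     0 \<in> D \<and> (\<exists>\<C>. (\<forall>C\<in>\<C>. periodic_orbit F S T C) \<and> D - {0} = \<Union>\<C>)"

definition coincide_near_0 :: "'a::real_normed_vector set \<Rightarrow> 'a set \<Rightarrow> bool" where
  "coincide_near_0 D D' \<longleftrightarrow> (\<exists>U. open U \<and> 0 \<in> U \<and> D \<inter> U = D' \<inter> U)"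

end

theory Submission
  imports Defs
begin

text \<open>
  Put \<open>l = \<omega> i\<close> and \<open>A = F'(0)\<close>, and let \<open>v\<close> span the eigenspace of \<open>l\<close>. The disk is the image of a
  solution \<open>f\<close> of \<open>l z f'(z) = F(f(z))\<close>, \<open>f(0) = 0\<close>, \<open>f'(0) = v\<close>: its orbits are
  \<open>t \<mapsto> f (z exp (l t))\<close>. As \<open>k l\<close> is not an eigenvalue for \<open>k \<ge> 2\<close>, the equation can be solved
  up to an error \<open>o(z\<^sup>m)\<close> for every \<open>m\<close>. For \<open>m\<close> large compared with the Lipschitz constant of \<open>F\<close>,
  Picard iteration of \<open>f(z) = \<integral>\<^sub>0\<^sup>z F(f(w)) / (l w) dw\<close> starting from such an approximation
  contracts differences measured in the weight \<open>\<bar>z\<bar>\<^sup>m\<close>.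

  Conversely, near \<open>0\<close> a disk filled with periodic orbits is a graph over one of the coordinates, \<open>F\<close> is
  tangent to it, and the induced one-dimensional field is holomorphic with a simple zero of
  multiplier \<open>\<mu>\<close>, an eigenvalue of \<open>A\<close>. Linearizing it gives a parametrization \<open>\<theta>\<close> with
  \<open>\<mu> u \<theta>'(u) = F(\<theta>(u))\<close>. Periodicity forces \<open>exp (\<mu> T) = 1\<close>, hence \<open>\<mu> = l\<close>, and then
  comparison of Taylor coefficients shows that \<open>\<theta>\<close> is \<open>f\<close> up to a scaling of the parameter.
\<close>

subsection \<open>Simple eigenvalues\<close>

lemma mat_minus_mult_vec: "(mat z - A) *v u = z *s u - A *v u" for A :: "complex ^ 'n ^ 'n"
proof -
  have "mat z *v u = z *s u"
    by (simp add: vec_eq_iff matrix_vector_mult_def mat_def if_distrib[of "\<lambda>a. a * _"] cong: if_cong)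
  then show ?thesis by (simp add: matrix_vector_mult_diff_rdistrib)
qed

lemma poly_charpoly: "poly (charpoly A) z = det (mat z - A)" for A :: "complex ^ 'n ^ 'n"
proof -
  have "poly (if P then [:0, 1:] - [:c:] else - [:c:]) z = (if P then z - c else - c)" for P and c :: complex
    by simp
  then show ?thesis
    unfolding charpoly_def det_def
    by (simp add: poly_sum poly_prod mat_def map_matrix_def if_distrib[of "\<lambda>p. poly p z"] cong: if_cong)
qed

lemma eigenvector_exists:
  fixes A :: "complex ^ 'n ^ 'n"
  assumes "poly (charpoly A) l = 0"
  obtains v where "v \<noteq> 0" "A *v v = l *s v"
proof -
  have "\<not> invertible (mat l - A)"
    using assms by (simp add: poly_charpoly invertible_det_nz)
  then obtain v where "v \<noteq> 0" "(mat l - A) *v v = 0"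
    using invertible_left_inverse matrix_left_invertible_ker by blast
  with that show ?thesis by (simp add: mat_minus_mult_vec)
qed

lemma eigenvalue_charpoly_root:
  fixes A :: "complex ^ 'n ^ 'n"
  assumes "v \<noteq> 0" "A *v v = l *s v"
  shows "poly (charpoly A) l = 0"
proof (rule ccontr)
  assume "poly (charpoly A) l \<noteq> 0"
  then have "invertible (mat l - A)"
    by (simp add: poly_charpoly invertible_det_nz)
  moreover have "(mat l - A) *v v = 0"
    using assms by (simp add: mat_minus_mult_vec)
  ultimately show False
    using assms(1) invertible_left_inverse matrix_left_invertible_ker by blast
qed

text \<open>At a multiple \<open>k l\<close> of the given eigenvalue, this is the linear equation
  that determines the Taylor coefficient of order \<open>k\<close> of the invariant disk.\<close>

lemma resolvent_surj:
  fixes A :: "complex ^ 'n ^ 'n"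
  assumes "poly (charpoly A) l \<noteq> 0"
  obtains e where "l *s e - A *v e = r"
proof -
  have "invertible (mat l - A)"
    using assms by (simp add: poly_charpoly invertible_det_nz)
  then obtain B where B: "(mat l - A) ** B = mat 1"
    unfolding invertible_def by blast
  have "(mat l - A) *v (B *v r) = r"
    by (simp add: matrix_vector_mul_assoc B)
  with that show ?thesis by (simp add: mat_minus_mult_vec)
qed

text \<open>If \<open>v $ k \<noteq> 0\<close>, replacing column \<open>k\<close> of \<open>mat z - A\<close> by \<open>v\<close> divides the determinant by
  \<open>z - l\<close> (up to the factor \<open>v $ k\<close>), so at a simple root the new matrix is invertible.\<close>

lemma simple_eigenspace:
  fixes A :: "complex ^ 'n ^ 'n"
  assumes nz: "charpoly A \<noteq> 0" and ord: "order l (charpoly A) = 1" and v: "v \<noteq> 0" "A *v v = l *s v"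
    and u: "A *v u = l *s u"
  obtains c where "u = c *s v"
proof -
  obtain k where k: "v $ k \<noteq> 0" using v(1) by (auto simp: vec_eq_iff)
  define N where "N z = ((\<chi> i j. if j = k then v $ i else (mat z - A) $ i $ j) :: complex ^ 'n ^ 'n)" for z
  obtain q where q: "charpoly A = [:- l, 1:] ^ 1 * q" "\<not> [:- l, 1:] dvd q"
    using order_decomp[OF nz, of l] ord by auto
  have ql: "poly q l \<noteq> 0" using q(2) by (simp add: poly_eq_0_iff_dvd)
  \<comment> \<open>One determinant is computed in two ways. Since
    \<open>(mat z - A) *v v = (z - l) *s v\<close>, replacing column \<open>k\<close> by this vector
    gives \<open>N z\<close> with that column scaled by \<open>z - l\<close>, while Cramer's lemma
    gives \<open>v $ k * det (mat z - A)\<close>.\<close>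
  have eq: "(z - l) * det (N z) = (z - l) * (v $ k * poly q z)" for z
  proof -
    have "det ((\<chi> i j. if j = k then ((mat z - A) *v v) $ i else (mat z - A) $ i $ j) :: complex ^ 'n ^ 'n)
        = v $ k * det (mat z - A)" by (rule cramer_lemma)
    moreover have "((\<chi> i j. if j = k then ((mat z - A) *v v) $ i else (mat z - A) $ i $ j) :: complex ^ 'n ^ 'n)
        = N z ** (\<chi> i j. if i = j then (if j = k then z - l else 1) else 0)"
    proof -
      have "(N z ** (\<chi> i j. if i = j then d i else 0)) $ i $ j = N z $ i $ j * d j" for d :: "'n \<Rightarrow> complex" and i j
        by (simp add: matrix_matrix_mult_def if_distrib[of "\<lambda>a. c * a" for c] cong: if_cong)
      from this[of "\<lambda>j. if j = k then z - l else 1"]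
      show ?thesis
        by (simp add: vec_eq_iff N_def mat_minus_mult_vec v left_diff_distrib right_diff_distrib mult.commute cong: if_cong)
    qed
    moreover have "det ((\<chi> i j. if i = j then (if j = k then z - l else 1) else 0) :: complex ^ 'n ^ 'n) = z - l"
      by (subst det_diagonal) (auto simp: prod.delta)
    moreover have "det (mat z - A) = (z - l) * poly q z"
      by (simp add: poly_charpoly[symmetric] q(1) algebra_simps)
    ultimately show ?thesis by (simp add: det_mul mult.commute mult.left_commute)
  qed
  have cN: "isCont (\<lambda>z. det (N z)) l"
  proof -
    have "isCont (\<lambda>z. N z $ i $ j) l" for i j
      by (cases "i = j"; cases "j = k") (auto simp: N_def mat_def intro!: continuous_intros)
    then show ?thesis
      unfolding det_def by (intro continuous_sum continuous_mult continuous_const continuous_prod)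
  qed
  \<comment> \<open>The factor \<open>z - l\<close> cancels only for \<open>z \<noteq> l\<close>;
    continuity of both sides gives the value at \<open>l\<close>.\<close>
  have "det (N l) = v $ k * poly q l"
  proof (rule LIM_unique)
    show "((\<lambda>z. det (N z)) \<longlongrightarrow> det (N l)) (at l)" using cN by (simp add: isCont_def)
    have "((\<lambda>z. v $ k * poly q z) \<longlongrightarrow> v $ k * poly q l) (at l)" by (intro tendsto_intros)
    moreover have "\<forall>\<^sub>F z in at l. v $ k * poly q z = det (N z)"
      unfolding eventually_at_filter by (rule always_eventually) (metis eq mult_left_cancel right_minus_eq)
    ultimately show "((\<lambda>z. det (N z)) \<longlongrightarrow> v $ k * poly q l) (at l)"
      by (rule Lim_transform_eventually)
  qed
  then have "invertible (N l)" using k ql by (simp add: invertible_det_nz)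
  then have inj: "\<And>x. N l *v x = 0 \<Longrightarrow> x = 0"
    using invertible_left_inverse matrix_left_invertible_ker by blast
  \<comment> \<open>This \<open>c\<close> makes coordinate \<open>k\<close> of \<open>w\<close>
    vanish. The replaced column of \<open>N l\<close> then does not act on \<open>w\<close>, so
    \<open>N l *v w = (mat l - A) *v w\<close>.\<close>
  define c where "c = u $ k / v $ k"
  define w where "w = u - c *s v"
  have wk: "w $ k = 0" using k by (simp add: w_def c_def)
  have "N l *v w = (mat l - A) *v w"
    using wk by (auto simp: vec_eq_iff matrix_vector_mult_def N_def intro!: sum.cong)
  also have "\<dots> = 0"
    unfolding mat_minus_mult_vec by (simp add: w_def u v matrix_vector_mult_diff_distrib vector_scalar_commute
        vec_eq_iff algebra_simps)
  finally have "w = 0" by (rule inj)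
  then have "u = c *s v" by (simp add: w_def)
  with that show ?thesis .
qed

text \<open>A second copy of \<open>l\<close> would remain in \<open>eigenvalues A - {#l#}\<close>
  with the integral quotient \<open>l / l = 1\<close>, so \<open>l\<close> is simple. The integer
  \<open>k\<close> may be zero or negative: \<open>k = 0\<close> gives the invertibility of
  \<open>A\<close>, and in the uniqueness proof the exponent is at first known only as some integer
  multiple of \<open>l\<close>.\<close>

lemma nonresonant_spectrum:
  fixes A :: "complex ^ 'n ^ 'n" and l :: complex
  assumes l: "l \<noteq> 0" "l \<in># eigenvalues A"
    and nr: "\<forall>\<mu> \<in># (eigenvalues A - {#l#}). \<mu> / l \<notin> \<int>"
  shows "charpoly A \<noteq> 0" and "order l (charpoly A) = 1"
    and "poly (charpoly A) (of_int k * l) = 0 \<Longrightarrow> k = 1"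
proof -
  show nz: "charpoly A \<noteq> 0" using l(2) by (auto simp: eigenvalues_def)
  have "l \<notin># eigenvalues A - {#l#}" using nr l(1) by auto
  then have "count (eigenvalues A) l \<le> 1" by (simp add: not_in_iff)
  moreover have "count (eigenvalues A) l \<noteq> 0" using l(2) by (simp add: count_eq_zero_iff)
  ultimately show "order l (charpoly A) = 1" using nz by (simp add: eigenvalues_def)
  assume "poly (charpoly A) (of_int k * l) = 0"
  then have k: "of_int k * l \<in># eigenvalues A" using nz by (simp add: eigenvalues_def)
  show "k = 1"
  proof (rule ccontr)
    assume "k \<noteq> 1"
    then have "of_int k * l \<noteq> l" using l(1) by simp
    then have "of_int k * l \<in># eigenvalues A - {#l#}" using k by (simp add: in_diff_count)
    then show False using nr l(1) by fastforce
  qed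
qed

subsection \<open>Holomorphic curves and maps\<close>

lemma norm_vector_smult: "norm (c *s v) = norm c * norm v" for v :: "complex ^ 'n"
  by (simp add: norm_vec_def norm_mult L2_set_right_distrib)

lemma scaleR_vector_smult: "(r *\<^sub>R c) *s v = r *\<^sub>R (c *s v)" for v :: "complex ^ 'n"
  by (simp add: vec_eq_iff)

lemma bounded_linear_axis: "bounded_linear (axis i :: 'a::real_normed_vector \<Rightarrow> 'a ^ 'n)"
  by (rule bounded_linear_intro[where K = 1])
     (auto simp: vec_eq_iff axis_def norm_vec_def L2_set_def if_distrib[of norm] if_distrib[of "\<lambda>t. t\<^sup>2"] cong: if_cong)

lemma has_derivative_vec_iff:
  fixes f :: "'a::real_normed_vector \<Rightarrow> 'b::real_normed_vector ^ 'n"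
  shows "(f has_derivative f') F \<longleftrightarrow> (\<forall>i. ((\<lambda>x. f x $ i) has_derivative (\<lambda>h. f' h $ i)) F)"
proof safe
  fix i assume "(f has_derivative f') F"
  then show "((\<lambda>x. f x $ i) has_derivative (\<lambda>h. f' h $ i)) F"
    by (rule bounded_linear.has_derivative[OF bounded_linear_vec_nth])
next
  assume *: "\<forall>i. ((\<lambda>x. f x $ i) has_derivative (\<lambda>h. f' h $ i)) F"
  have v: "v = (\<Sum>i\<in>UNIV. axis i (v $ i))" for v :: "'b ^ 'n"
    by (simp add: vec_eq_iff axis_def if_distrib cong: if_cong)
  have "((\<lambda>x. \<Sum>i\<in>UNIV. axis i (f x $ i)) has_derivative (\<lambda>h. \<Sum>i\<in>UNIV. axis i (f' h $ i))) F"
    using * by (intro has_derivative_sum bounded_linear.has_derivative[OF bounded_linear_axis]) auto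
  then show "(f has_derivative f') F" by (simp flip: v)
qed

section \<open>Vector-valued holomorphic functions of one variable\<close>

text \<open>Coordinatewise, as in \<open>holomorphic_disk_embedding\<close>, so that one-variable
  complex analysis applies to each coordinate.\<close>

definition vholomorphic_on :: "(complex \<Rightarrow> complex ^ 'n) \<Rightarrow> complex set \<Rightarrow> bool" where
  "vholomorphic_on f S \<longleftrightarrow> (\<forall>i. (\<lambda>z. f z $ i) holomorphic_on S)"

definition vderiv :: "(complex \<Rightarrow> complex ^ 'n) \<Rightarrow> complex \<Rightarrow> complex ^ 'n" where
  "vderiv f z = (\<chi> i. deriv (\<lambda>w. f w $ i) z)"

lemma vderiv_nth: "vderiv f z $ i = deriv (\<lambda>w. f w $ i) z"
  by (simp add: vderiv_def)

lemma vholomorphic_on_subset: "vholomorphic_on f S \<Longrightarrow> T \<subseteq> S \<Longrightarrow> vholomorphic_on f T"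
  by (meson vholomorphic_on_def holomorphic_on_subset)

lemma vholomorphic_has_field_derivative:
  assumes "vholomorphic_on f S" "open S" "z \<in> S"
  shows "((\<lambda>w. f w $ i) has_field_derivative vderiv f z $ i) (at z)"
  using assms by (auto simp: vholomorphic_on_def vderiv_def intro: holomorphic_derivI)

lemma vholomorphic_has_derivative:
  assumes "vholomorphic_on f S" "open S" "z \<in> S"
  shows "(f has_derivative (\<lambda>h. h *s vderiv f z)) (at z)"
  unfolding has_derivative_vec_iff
  using vholomorphic_has_field_derivative[OF assms]
  by (simp add: has_field_derivative_def mult_commute_abs)

lemma vholomorphic_imp_continuous_on: "vholomorphic_on f S \<Longrightarrow> continuous_on S f"
  using continuous_on_vec_lambda[of S "\<lambda>i x. f x $ i"]
  by (auto simp: vholomorphic_on_def intro: holomorphic_on_imp_continuous_on)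

lemma vholomorphic_curve:
  assumes "vholomorphic_on f S" "open S" "z t \<in> S" "(z has_vector_derivative z') (at t)"
  shows "((\<lambda>t. f (z t)) has_vector_derivative z' *s vderiv f (z t)) (at t)"
proof -
  have "(f has_derivative (\<lambda>h. h *s vderiv f (z t))) (at (z t))"
    by (rule vholomorphic_has_derivative[OF assms(1-3)])
  from has_derivative_compose[OF assms(4)[unfolded has_vector_derivative_def] this]
  show ?thesis
    by (simp add: has_vector_derivative_def scaleR_vector_smult)
qed

lemma has_derivative_imp_vderiv:
  fixes f :: "complex \<Rightarrow> complex ^ 'n"
  assumes "(f has_derivative (\<lambda>h. h *s v)) (at z)"
  shows "\<And>i. ((\<lambda>w. f w $ i) has_field_derivative v $ i) (at z)" "vderiv f z = v"
proof -
  show *: "((\<lambda>w. f w $ i) has_field_derivative v $ i) (at z)" for i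
    using assms unfolding has_derivative_vec_iff has_field_derivative_def
    by (simp add: mult_commute_abs)
  show "vderiv f z = v"
    using DERIV_imp_deriv[OF *] by (simp add: vec_eq_iff vderiv_def)
qed

lemma vholomorphic_onI:
  assumes "\<And>z. z \<in> S \<Longrightarrow> (f has_derivative (\<lambda>h. h *s f' z)) (at z)"
  shows "vholomorphic_on f S"
  unfolding vholomorphic_on_def holomorphic_on_def field_differentiable_def
proof (intro allI ballI)
  fix i z assume "z \<in> S"
  from has_field_derivative_at_within[OF has_derivative_imp_vderiv(1)[OF assms[OF this]]]
  show "\<exists>d. ((\<lambda>z. f z $ i) has_field_derivative d) (at z within S)" by (rule exI)
qed

lemma has_derivative_compose_vholomorphic:
  assumes "vholomorphic_on f S" "open S" "z \<in> S" "(F has_derivative (*v) A) (at (f z))"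
  shows "((\<lambda>z. F (f z)) has_derivative (\<lambda>h. h *s (A *v vderiv f z))) (at z)"
  using has_derivative_compose[OF vholomorphic_has_derivative[OF assms(1-3)] assms(4)]
  by (simp add: vector_scalar_commute)

lemma vholomorphic_compose_scalar:
  assumes "vholomorphic_on f T" "open T" "g holomorphic_on S" "open S" "g ` S \<subseteq> T"
  shows "vholomorphic_on (\<lambda>z. f (g z)) S"
    and "z \<in> S \<Longrightarrow> vderiv (\<lambda>z. f (g z)) z = deriv g z *s vderiv f (g z)"
proof -
  have *: "((\<lambda>z. f (g z)) has_derivative (\<lambda>h. h *s (deriv g z *s vderiv f (g z)))) (at z)" if "z \<in> S" for z
  proof -
    have "(g has_derivative (*) (deriv g z)) (at z)"
      using holomorphic_derivI[OF assms(3,4) that] by (simp add: has_field_derivative_def)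
    moreover have "(f has_derivative (\<lambda>h. h *s vderiv f (g z))) (at (g z))"
      using assms that by (intro vholomorphic_has_derivative) auto
    ultimately show ?thesis
      using has_derivative_compose by (fastforce simp: vec_eq_iff mult_ac)
  qed
  show "vholomorphic_on (\<lambda>z. f (g z)) S" by (rule vholomorphic_onI[OF *])
  show "z \<in> S \<Longrightarrow> vderiv (\<lambda>z. f (g z)) z = deriv g z *s vderiv f (g z)"
    by (rule has_derivative_imp_vderiv(2)[OF *])
qed

lemma holomorphic_map_derivative:
  assumes "holomorphic_map_on F S" "open S" "x \<in> S"
  obtains A where "(F has_derivative (*v) A) (at x)"
  using assms unfolding holomorphic_map_on_def by (metis at_within_open)

lemma vholomorphic_compose_map:
  assumes "holomorphic_map_on F U" "open U" "vholomorphic_on f S" "open S" "f ` S \<subseteq> U"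
  shows "vholomorphic_on (\<lambda>z. F (f z)) S"
proof -
  have "\<exists>A. (F has_derivative (*v) A) (at (f z))" if "z \<in> S" for z
    using holomorphic_map_derivative[OF assms(1,2)] assms(5) that by blast
  then obtain A where A: "\<And>z. z \<in> S \<Longrightarrow> (F has_derivative (*v) (A z)) (at (f z))"
    by metis
  show ?thesis
    by (rule vholomorphic_onI[OF has_derivative_compose_vholomorphic]) (use assms A in auto)
qed

text \<open>Cauchy estimates on complex lines; this replaces continuity of \<open>F'\<close>, which
  \<^const>\<open>holomorphic_map_on\<close> does not provide directly.\<close>

lemma holomorphic_map_lipschitz:
  fixes G :: "complex ^ 'n \<Rightarrow> complex ^ 'm"
  assumes G: "holomorphic_map_on G (ball 0 (2 * \<rho>))" and rho: "\<rho> > 0" and M: "M > 0"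
    and bd: "\<And>x. x \<in> ball 0 (2 * \<rho>) \<Longrightarrow> norm (G x) \<le> M"
    and xy: "x \<in> ball 0 \<rho>" "y \<in> ball 0 \<rho>"
  shows "norm (G x - G y) \<le> (CARD('m) * (4 * M / \<rho>)) * norm (x - y)"
proof -
  have "\<exists>A. (G has_derivative (*v) A) (at x)" if "x \<in> ball 0 (2 * \<rho>)" for x
    using holomorphic_map_derivative[OF G] that by blast
  then obtain A where A: "\<And>x. x \<in> ball 0 (2 * \<rho>) \<Longrightarrow> (G has_derivative (*v) (A x)) (at x)"
    by metis
  have comp: "norm ((A x *v h) $ i) \<le> 4 * M / \<rho> * norm h" if x: "x \<in> ball 0 \<rho>" for x h i
  proof (cases "h = 0")
    case False
    define e where "e = (1 / of_real (norm h)) *s h"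
    have e: "norm e = 1" "h = of_real (norm h) *s e"
      using False by (auto simp: e_def norm_vector_smult norm_divide)
    \<comment> \<open>The complex line through \<open>x\<close> in the unit direction
      \<open>e\<close>: for \<open>norm \<zeta> < \<rho>\<close> it stays in the ball of radius
      \<open>2 * \<rho>\<close>.\<close>
    define f where "f \<zeta> = x + \<zeta> *s e" for \<zeta>
    have fd: "(f has_derivative (\<lambda>h. h *s e)) (at \<zeta>)" for \<zeta>
      unfolding has_derivative_vec_iff f_def by (auto intro!: derivative_eq_intros)
    have f: "vholomorphic_on f UNIV" "vderiv f 0 = e"
      using vholomorphic_onI[OF fd] has_derivative_imp_vderiv(2)[OF fd] by auto
    have inb: "f \<zeta> \<in> ball 0 (2 * \<rho>)" if "\<zeta> \<in> ball 0 \<rho>" for \<zeta>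
      using norm_triangle_ineq[of x "\<zeta> *s e"] x that by (auto simp: f_def norm_vector_smult e)
    have Gf: "vholomorphic_on (\<lambda>\<zeta>. G (f \<zeta>)) (ball 0 \<rho>)"
      by (rule vholomorphic_compose_map[OF G]) (use inb vholomorphic_on_subset[OF f(1)] in auto)
    have "f 0 = x" by (simp add: f_def)
    have "x \<in> ball 0 (2 * \<rho>)" using x rho by auto
    from A[OF this] have d: "((\<lambda>\<zeta>. G (f \<zeta>)) has_derivative (\<lambda>h. h *s (A x *v e))) (at 0)"
      using has_derivative_compose_vholomorphic[OF f(1), of 0 G "A x"] \<open>f 0 = x\<close> f(2) by simp
    have sub: "cball 0 (\<rho> / 2) \<subseteq> ball (0 :: complex) \<rho>" using rho by auto
    have hol: "(\<lambda>\<zeta>. G (f \<zeta>) $ i) holomorphic_on cball 0 (\<rho> / 2)"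
      using Gf sub holomorphic_on_subset by (auto simp: vholomorphic_on_def)
    \<comment> \<open>Cauchy's estimate on the disk of radius \<open>\<rho> / 2\<close>. The values
      have to lie in an open ball, hence \<open>2 * M\<close> instead of \<open>M\<close>; together
      this gives \<open>4 * M / \<rho>\<close>.\<close>
    have "norm ((deriv ^^ 1) (\<lambda>\<zeta>. G (f \<zeta>) $ i) 0) \<le> fact 1 * (2 * M) / (\<rho> / 2) ^ 1"
    proof (rule Cauchy_higher_deriv_bound[where y = 0])
      show "(\<lambda>\<zeta>. G (f \<zeta>) $ i) holomorphic_on ball 0 (\<rho> / 2)"
        using hol holomorphic_on_subset ball_subset_cball by blast
      show "continuous_on (cball 0 (\<rho> / 2)) (\<lambda>\<zeta>. G (f \<zeta>) $ i)"
        using hol by (rule holomorphic_on_imp_continuous_on)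
      fix \<zeta> :: complex assume "\<zeta> \<in> ball 0 (\<rho> / 2)"
      then have "norm (G (f \<zeta>)) \<le> M" using inb bd rho by auto
      then have "norm (G (f \<zeta>) $ i) \<le> M" using Finite_Cartesian_Product.norm_nth_le[of "G (f \<zeta>)" i] by linarith
      then show "G (f \<zeta>) $ i \<in> ball 0 (2 * M)" using M by auto
    qed (use rho in auto)
    then have Ae: "norm ((A x *v e) $ i) \<le> 4 * M / \<rho>"
      using DERIV_imp_deriv[OF has_derivative_imp_vderiv(1)[OF d]] by simp
    have "(A x *v h) $ i = of_real (norm h) * (A x *v e) $ i"
      by (subst e(2)) (simp add: vector_scalar_commute)
    then have "norm ((A x *v h) $ i) = norm h * norm ((A x *v e) $ i)"
      by (simp add: norm_mult)
    also have "\<dots> \<le> norm h * (4 * M / \<rho>)"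
      by (intro mult_left_mono Ae) auto
    finally show ?thesis by (simp add: mult.commute)
  qed simp
  have on: "onorm ((*v) (A x)) \<le> CARD('m) * (4 * M / \<rho>)" if x: "x \<in> ball 0 \<rho>" for x
  proof (rule onorm_le)
    fix h
    have "norm (A x *v h) \<le> (\<Sum>i\<in>UNIV. norm ((A x *v h) $ i))"
      unfolding norm_vec_def by (rule L2_set_le_sum) simp
    also have "\<dots> \<le> (\<Sum>i::'m\<in>UNIV. 4 * M / \<rho> * norm h)"
      by (rule sum_mono) (rule comp[OF x])
    also have "\<dots> = CARD('m) * (4 * M / \<rho>) * norm h"
      by (simp only: sum_constant mult.assoc)
    finally show "norm (A x *v h) \<le> CARD('m) * (4 * M / \<rho>) * norm h" .
  qed
  have der: "(G has_derivative (*v) (A x)) (at x within ball 0 \<rho>)" if "x \<in> ball 0 \<rho>" for x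
    by (rule has_derivative_at_withinI[OF A]) (use that rho in simp)
  show ?thesis
    by (rule differentiable_bound[where f' = "\<lambda>x. (*v) (A x)", OF convex_ball der on xy])
qed

text \<open>Strict differentiability at \<open>0\<close>. The remainder \<open>N\<close> is at most
  \<open>e * (2 * \<rho>)\<close> on the ball of radius \<open>2 * \<rho>\<close>, and the Lipschitz
  bound from Cauchy's estimate divides this by \<open>\<rho>\<close>. The resulting constant does
  not depend on \<open>\<rho>\<close>, and \<open>e\<close> is chosen to make it
  \<open>\<epsilon>\<close>.\<close>

lemma holomorphic_map_linear_part:
  assumes F: "holomorphic_map_on F (ball 0 R)" "R > 0" "F 0 = 0"
    and A: "(F has_derivative (*v) A) (at 0)" and eps: "\<epsilon> > 0"
  obtains \<rho> where "\<rho> > 0" "\<rho> \<le> R"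
    "\<And>x y. x \<in> ball 0 \<rho> \<Longrightarrow> y \<in> ball 0 \<rho> \<Longrightarrow> norm (F x - F y - A *v (x - y)) \<le> \<epsilon> * norm (x - y)"
proof -
  let ?n = "real CARD('b)"
  define N where "N x = F x - A *v x" for x
  define e where "e = \<epsilon> / (8 * ?n)"
  have e: "e > 0" using eps by (simp add: e_def)
  obtain d where d: "d > 0" "\<And>x. norm x < d \<Longrightarrow> norm (N x) \<le> e * norm x"
    using A e F(3) unfolding has_derivative_at_alt N_def by fastforce
  define \<rho> where "\<rho> = min d R / 2"
  have rho: "\<rho> > 0" "2 * \<rho> \<le> d" "2 * \<rho> \<le> R" using d F(2) by (auto simp: \<rho>_def)
  have hN: "holomorphic_map_on N (ball 0 (2 * \<rho>))"
    unfolding holomorphic_map_on_def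
  proof
    fix x :: "complex ^ 'a" assume "x \<in> ball 0 (2 * \<rho>)"
    then have "x \<in> ball 0 R" using rho by auto
    then obtain B where B: "(F has_derivative (*v) B) (at x)"
      using holomorphic_map_derivative[OF F(1)] by auto
    have "(N has_derivative (\<lambda>h. B *v h - A *v h)) (at x within ball 0 (2 * \<rho>))"
      unfolding N_def
      by (rule has_derivative_diff[OF has_derivative_at_withinI[OF B]
            bounded_linear_imp_has_derivative[OF matrix_vector_mul_bounded_linear]])
    then show "\<exists>B. (N has_derivative (*v) B) (at x within ball 0 (2 * \<rho>))"
      by (auto simp flip: matrix_vector_mult_diff_rdistrib)
  qed
  have bd: "norm (N x) \<le> e * (2 * \<rho>)" if "x \<in> ball 0 (2 * \<rho>)" for x
  proof -
    have "norm (N x) \<le> e * norm x" using d(2) that rho by auto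
    also have "\<dots> \<le> e * (2 * \<rho>)" using that e by (intro mult_left_mono) auto
    finally show ?thesis .
  qed
  have "norm (F x - F y - A *v (x - y)) \<le> \<epsilon> * norm (x - y)" if "x \<in> ball 0 \<rho>" "y \<in> ball 0 \<rho>" for x y
  proof -
    have "norm (N x - N y) \<le> (?n * (4 * (e * (2 * \<rho>)) / \<rho>)) * norm (x - y)"
      by (rule holomorphic_map_lipschitz[OF hN _ _ bd that]) (use rho e in auto)
    also have "?n * (4 * (e * (2 * \<rho>)) / \<rho>) = \<epsilon>"
      using rho by (simp add: e_def field_simps)
    finally show ?thesis by (simp add: N_def matrix_vector_mult_diff_distrib algebra_simps)
  qed
  then show ?thesis using rho by (intro that[of \<rho>]) auto
qed

section \<open>Order of vanishing at 0, expressed by limits\<close>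

text \<open>The quotient \<open>f z / z ^ m\<close> has a limit at \<open>0\<close>, so its
  singularity there is removable and \<open>r\<close> is its extension.\<close>

lemma holomorphic_factor_power:
  assumes f: "f holomorphic_on ball 0 \<delta>" and lim: "((\<lambda>z. f z / z ^ m) \<longlongrightarrow> c) (at 0)"
  obtains r where "r holomorphic_on ball 0 \<delta>" "r 0 = c" "\<And>z. z \<noteq> 0 \<Longrightarrow> f z = z ^ m * r z"
proof
  let ?r = "\<lambda>z. if z = 0 then c else f z / z ^ m"
  show "?r holomorphic_on ball 0 \<delta>"
  proof (rule no_isolated_singularity'[where K = "{0}"])
    have "(\<lambda>z. f z / z ^ m) holomorphic_on ball 0 \<delta> - {0}"
      using f by (intro holomorphic_intros) (auto intro: holomorphic_on_subset)
    then show "?r holomorphic_on ball 0 \<delta> - {0}"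
      by (rule holomorphic_transform) auto
    have "(?r \<longlongrightarrow> c) (at 0)"
      using lim by (rule Lim_transform_eventually) (auto simp: eventually_at_filter)
    then show "(?r \<longlongrightarrow> ?r z) (at z within ball 0 \<delta>)" if "z \<in> {0}" for z
      using that by (auto intro: tendsto_within_subset)
  qed auto
qed auto

text \<open>The extension of \<open>f z / z ^ m\<close> vanishes at \<open>0\<close>; its derivative
  there is the required limit.\<close>

lemma holomorphic_order_step:
  assumes "f holomorphic_on ball 0 \<delta>" "\<delta> > 0" "((\<lambda>z. f z / z ^ m) \<longlongrightarrow> 0) (at 0)"
  obtains c where "((\<lambda>z. f z / z ^ Suc m) \<longlongrightarrow> c) (at 0)"
proof -
  obtain r where r: "r holomorphic_on ball 0 \<delta>" "r 0 = 0" "\<And>z. z \<noteq> 0 \<Longrightarrow> f z = z ^ m * r z"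
    using holomorphic_factor_power[OF assms(1,3)] by metis
  have "(r has_field_derivative deriv r 0) (at 0)"
    using r(1) assms(2) by (intro holomorphic_derivI[where S = "ball 0 \<delta>"]) auto
  then have "((\<lambda>z. r z / z) \<longlongrightarrow> deriv r 0) (at 0)"
    using r(2) by (simp add: has_field_derivative_iff)
  then have "((\<lambda>z. f z / z ^ Suc m) \<longlongrightarrow> deriv r 0) (at 0)"
    by (rule Lim_transform_eventually) (auto simp: eventually_at_filter r(3))
  then show ?thesis by (rule that)
qed

text \<open>The Euler operator multiplies the coefficient of \<open>z ^ m\<close> by
  \<open>m\<close>: apply the product rule to \<open>f z = z ^ m * r z\<close>.\<close>

lemma holomorphic_order_deriv:
  assumes "f holomorphic_on ball 0 \<delta>" "\<delta> > 0" "((\<lambda>z. f z / z ^ m) \<longlongrightarrow> c) (at 0)"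
  shows "((\<lambda>z. z * deriv f z / z ^ m) \<longlongrightarrow> of_nat m * c) (at 0)"
proof -
  obtain r where r: "r holomorphic_on ball 0 \<delta>" "r 0 = c" "\<And>z. z \<noteq> 0 \<Longrightarrow> f z = z ^ m * r z"
    using holomorphic_factor_power[OF assms(1,3)] by metis
  have d: "z * deriv f z / z ^ m = of_nat m * r z + z * deriv r z" if "z \<in> ball 0 \<delta> - {0}" for z
  proof -
    have "((\<lambda>z. z ^ m * r z) has_field_derivative (of_nat m * z ^ (m - 1) * r z + z ^ m * deriv r z)) (at z)"
      using that by (auto intro!: derivative_eq_intros holomorphic_derivI[OF r(1)])
    then have "(f has_field_derivative (of_nat m * z ^ (m - 1) * r z + z ^ m * deriv r z)) (at z)"
      by (rule has_field_derivative_transform_within_open[where S = "- {0}"]) (use that r(3) in auto)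
    then have "deriv f z = of_nat m * z ^ (m - 1) * r z + z ^ m * deriv r z"
      by (rule DERIV_imp_deriv)
    then show ?thesis using that by (cases m) (auto simp: field_simps)
  qed
  have "((\<lambda>z. of_nat m * r z + z * deriv r z) \<longlongrightarrow> of_nat m * r 0 + 0 * deriv r 0) (at 0)"
  proof (intro tendsto_intros)
    have "isCont r 0" "isCont (deriv r) 0"
      using r(1) assms(2) holomorphic_deriv[OF r(1)]
      by (auto intro!: continuous_on_interior[of "ball 0 \<delta>"] holomorphic_on_imp_continuous_on simp: interior_open)
    then show "(r \<longlongrightarrow> r 0) (at 0)" "(deriv r \<longlongrightarrow> deriv r 0) (at 0)"
      by (auto simp: isCont_def)
  qed
  then have "((\<lambda>z. z * deriv f z / z ^ m) \<longlongrightarrow> of_nat m * r 0 + 0 * deriv r 0) (at 0)"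
    by (rule Lim_transform_eventually)
       (use assms(2) d in \<open>auto simp: eventually_at intro!: exI[of _ \<delta>]\<close>)
  then show ?thesis using r(2) by simp
qed

text \<open>The limit for order zero gives \<open>f 0 = 0\<close>. A nonconstant \<open>f\<close>
  would then factor as \<open>z ^ n * g z\<close> with \<open>g 0 \<noteq> 0\<close>, against the
  limit for order \<open>n\<close>.\<close>

lemma holomorphic_infinite_order:
  assumes f: "f holomorphic_on ball 0 \<delta>" and "\<delta> > 0" and lim: "\<And>m. ((\<lambda>z. f z / z ^ m) \<longlongrightarrow> 0) (at 0)"
    and z: "z \<in> ball 0 \<delta>"
  shows "f z = 0"
proof (rule ccontr)
  assume nz: "f z \<noteq> 0"
  have "isCont f 0" using f \<open>\<delta> > 0\<close>
    by (auto intro!: continuous_on_interior[of "ball 0 \<delta>"] holomorphic_on_imp_continuous_on simp: interior_open)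
  then have f0: "f 0 = 0"
    using lim[of 0] LIM_unique by (auto simp: isCont_def)
  have "\<not> f constant_on ball 0 \<delta>"
    using nz f0 z \<open>\<delta> > 0\<close> unfolding constant_on_def by (metis centre_in_ball)
  then obtain g r n where g: "0 < n" "0 < r" "g holomorphic_on ball 0 r"
      "\<And>w. w \<in> ball 0 r \<Longrightarrow> f w = (w - 0) ^ n * g w" "\<And>w. w \<in> ball 0 r \<Longrightarrow> g w \<noteq> 0"
    using holomorphic_factor_zero_nonconstant[OF f open_ball connected_ball _ f0] \<open>\<delta> > 0\<close>
    by (metis centre_in_ball)
  have "isCont g 0" using g(2,3)
    by (auto intro!: continuous_on_interior[of "ball 0 r"] holomorphic_on_imp_continuous_on simp: interior_open)
  then have "((\<lambda>z. f z / z ^ n) \<longlongrightarrow> g 0) (at 0)"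
    unfolding isCont_def
    by (rule Lim_transform_eventually) (use g in \<open>auto simp: eventually_at intro!: exI[of _ r]\<close>)
  then have "g 0 = 0" using lim[of n] LIM_unique by blast
  then show False using g by auto
qed

lemma vholomorphic_small_ball:
  assumes "vholomorphic_on p (ball 0 \<delta>)" "\<delta> > 0" "p 0 = 0" "\<rho> > 0"
  obtains d where "d > 0" "d \<le> \<delta>" "p ` ball 0 d \<subseteq> ball 0 \<rho>"
proof -
  have "isCont p 0"
    using vholomorphic_imp_continuous_on[OF assms(1)] assms(2)
    by (auto intro!: continuous_on_interior[of "ball 0 \<delta>"] simp: interior_open)
  then obtain d where "d > 0" "\<And>z. dist z 0 < d \<Longrightarrow> dist (p z) (p 0) < \<rho>"
    using assms(4) by (auto simp: continuous_at_eps_delta)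
  then show ?thesis
    using assms(2,3) by (intro that[of "min d \<delta>"]) (auto simp: dist_commute)
qed

lemma vholomorphic_order_step:
  assumes f: "vholomorphic_on f (ball 0 \<delta>)" "\<delta> > 0"
    and lim: "((\<lambda>z. inverse (z ^ m) *s f z) \<longlongrightarrow> 0) (at 0)"
  obtains c :: "complex ^ 'n" where "((\<lambda>z. inverse (z ^ Suc m) *s f z) \<longlongrightarrow> c) (at 0)"
proof -
  have "\<exists>c. ((\<lambda>z. f z $ i / z ^ Suc m) \<longlongrightarrow> c) (at 0)" for i
  proof -
    have "((\<lambda>z. f z $ i / z ^ m) \<longlongrightarrow> 0) (at 0)"
      using tendsto_vec_nth[OF lim, of i] by (simp add: field_simps)
    moreover have "(\<lambda>z. f z $ i) holomorphic_on ball 0 \<delta>"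
      using f(1) by (simp add: vholomorphic_on_def)
    ultimately obtain c where "((\<lambda>z. f z $ i / z ^ Suc m) \<longlongrightarrow> c) (at 0)"
      using holomorphic_order_step[where f = "\<lambda>z. f z $ i", OF _ f(2)] by blast
    then show ?thesis ..
  qed
  then obtain c where c: "\<And>i. ((\<lambda>z. f z $ i / z ^ Suc m) \<longlongrightarrow> c i) (at 0)" by metis
  show ?thesis
  proof (rule that[of "\<chi> i. c i"], rule vec_tendstoI)
    fix i show "((\<lambda>z. (inverse (z ^ Suc m) *s f z) $ i) \<longlongrightarrow> (\<chi> i. c i) $ i) (at 0)"
      using c[of i] by (simp add: divide_inverse mult.commute)
  qed
qed

lemma has_derivative_add_monomial:
  assumes "vholomorphic_on p UNIV"
  shows "((\<lambda>z. p z + z ^ k *s e) has_derivative (\<lambda>h. h *s (vderiv p z + (of_nat k * z ^ (k - 1)) *s e))) (at z)"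
  unfolding has_derivative_vec_iff
proof
  fix i
  have "((\<lambda>z. p z $ i + z ^ k * e $ i) has_field_derivative
      (vderiv p z $ i + of_nat k * z ^ (k - 1) * e $ i)) (at z)"
    by (auto intro!: derivative_eq_intros vholomorphic_has_field_derivative[OF assms])
  moreover have "(\<lambda>h. (h *s (vderiv p z + (of_nat k * z ^ (k - 1)) *s e)) $ i)
      = (*) (vderiv p z $ i + of_nat k * z ^ (k - 1) * e $ i)"
    by (auto simp: fun_eq_iff algebra_simps)
  ultimately show "((\<lambda>z. (p z + z ^ k *s e) $ i) has_derivative
      (\<lambda>h. (h *s (vderiv p z + (of_nat k * z ^ (k - 1)) *s e)) $ i)) (at z)"
    by (simp add: has_field_derivative_def)
qed

section \<open>Local normal forms of embedded disks and of one-dimensional fields\<close>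

text \<open>Being an immersion provides a coordinate with nonzero derivative at \<open>b\<close>,
  which can serve as the local parameter. Being a homeomorphism onto the image excludes further
  sheets of the disk near \<open>0\<close>; this is what \<open>U\<close> records.\<close>

lemma disk_as_graph:
  fixes \<psi> :: "complex \<Rightarrow> complex ^ 'n"
  assumes emb: "holomorphic_disk_embedding \<psi> (ball a r)" and b: "b \<in> ball a r" "\<psi> b = 0"
  obtains i \<delta> U and \<Psi> :: "complex \<Rightarrow> complex ^ 'n" where "\<delta> > 0" "vholomorphic_on \<Psi> (ball 0 \<delta>)" "\<Psi> 0 = 0"
    "\<And>w. w \<in> ball 0 \<delta> \<Longrightarrow> \<Psi> w $ i = w" "open U" "0 \<in> U" "\<psi> ` ball a r \<inter> U = \<Psi> ` ball 0 \<delta>"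
proof -
  have h: "vholomorphic_on \<psi> (ball a r)" using emb by (simp add: holomorphic_disk_embedding_def vholomorphic_on_def)
  obtain \<sigma> where hom: "homeomorphism (ball a r) (\<psi> ` ball a r) \<psi> \<sigma>"
    using emb by (auto simp: holomorphic_disk_embedding_def)
  obtain i where i: "deriv (\<lambda>w. \<psi> w $ i) b \<noteq> 0" using emb b unfolding holomorphic_disk_embedding_def by blast
  define f where "f = (\<lambda>w. \<psi> w $ i)"
  have f: "f holomorphic_on ball a r" using h by (simp add: vholomorphic_on_def f_def)
  obtain e where e: "e > 0" "ball b e \<subseteq> ball a r" "inj_on f (ball b e)"
    using has_complex_derivative_locally_injective[OF f b(1) open_ball] i f_def by auto
  have fe: "f holomorphic_on ball b e" using f e(2) holomorphic_on_subset by blast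
  obtain \<tau> where \<tau>: "\<tau> holomorphic_on (f ` ball b e)" "\<And>z. z \<in> ball b e \<Longrightarrow> \<tau> (f z) = z"
    using holomorphic_has_inverse[OF fe open_ball e(3)] by metis
  have op: "open (f ` ball b e)" by (rule open_mapping_thm3[OF fe open_ball e(3)])
  have fb: "f b = 0" using b by (simp add: f_def)
  have "0 \<in> f ` ball b e" using fb e(1) by (metis centre_in_ball imageI)
  then obtain \<delta> where \<delta>: "\<delta> > 0" "ball 0 \<delta> \<subseteq> f ` ball b e" using op open_contains_ball by blast
  have \<tau>b: "\<tau> w \<in> ball b e" "f (\<tau> w) = w" if "w \<in> ball 0 \<delta>" for w
    using \<delta>(2) \<tau>(2) that by force+
  define \<Psi> where "\<Psi> w = \<psi> (\<tau> w)" for w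
  define V where "V = ball b e \<inter> f -` ball 0 \<delta>"
  have "open V"
    unfolding V_def by (rule continuous_open_preimage[OF holomorphic_on_imp_continuous_on[OF fe] open_ball open_ball])
  have tV: "\<tau> ` ball 0 \<delta> = V"
  proof
    show "\<tau> ` ball 0 \<delta> \<subseteq> V" using \<tau>b by (auto simp: V_def)
    show "V \<subseteq> \<tau> ` ball 0 \<delta>"
    proof
      fix z assume "z \<in> V"
      then have "\<tau> (f z) = z" "f z \<in> ball 0 \<delta>" using \<tau>(2) by (auto simp: V_def)
      then show "z \<in> \<tau> ` ball 0 \<delta>" by (metis imageI)
    qed
  qed
  \<comment> \<open>The homeomorphism turns the open parameter set \<open>V\<close> into a
    relatively open piece of the disk, which is therefore cut out by an open
    \<open>U\<close>.\<close>
  have "openin (top_of_set (ball a r)) V"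
    using \<open>open V\<close> e(2) by (intro open_openin_trans) (auto simp: V_def)
  then have "openin (top_of_set (\<psi> ` ball a r)) (\<psi> ` V)"
    by (rule homeomorphism_imp_open_map[OF hom])
  then obtain U where U: "open U" "\<psi> ` V = \<psi> ` ball a r \<inter> U" by (auto simp: openin_open)
  have img: "\<psi> ` ball a r \<inter> U = \<Psi> ` ball 0 \<delta>"
    using U(2) tV unfolding \<Psi>_def by (metis image_image)
  have \<tau>0: "\<tau> 0 = b" using \<tau>(2)[of b] fb e(1) by simp
  show ?thesis
  proof (rule that[OF \<delta>(1) _ _ _ U(1) _ img])
    show "vholomorphic_on \<Psi> (ball 0 \<delta>)"
      unfolding \<Psi>_def
      by (rule vholomorphic_compose_scalar(1)[OF h open_ball _ open_ball])
         (use \<tau>(1) \<delta>(2) \<tau>b e(2) in \<open>auto intro: holomorphic_on_subset\<close>)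
    show \<Psi>0: "\<Psi> 0 = 0" by (simp add: \<Psi>_def \<tau>0 b)
    show "\<Psi> w $ i = w" if "w \<in> ball 0 \<delta>" for w using \<tau>b[OF that] by (simp add: \<Psi>_def f_def)
    have "0 \<in> \<Psi> ` ball 0 \<delta>" using \<Psi>0 \<delta>(1) by (metis centre_in_ball imageI)
    then show "0 \<in> U" using img by blast
  qed
qed

text \<open>For \<open>h w = w * exp (H w)\<close> the equation \<open>h' g = \<mu> h\<close> reads
  \<open>H' = \<mu> / g - 1 / w\<close>. The poles cancel because \<open>\<mu>\<close> is the
  derivative of \<open>g\<close> at \<open>0\<close>, which leaves \<open>H' = g2 / g1\<close> where
  \<open>g w = w * g1 w\<close>. In the coordinate \<open>u = h w\<close> the field
  \<open>w' = g w\<close> becomes \<open>u' = \<mu> u\<close>.\<close>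

lemma linearize_at_simple_zero:
  assumes g: "g holomorphic_on ball 0 \<delta>" "\<delta> > 0" "g 0 = 0" "deriv g 0 = \<mu>" "\<mu> \<noteq> 0"
  obtains h e where "e > 0" "e \<le> \<delta>" "h holomorphic_on ball 0 e" "h 0 = 0" "inj_on h (ball 0 e)"
    "\<And>w. w \<in> ball 0 e \<Longrightarrow> deriv h w * g w = \<mu> * h w"
proof -
  define g1 where "g1 w = (if w = 0 then deriv g 0 else (g w - g 0) / (w - 0))" for w
  have g1: "g1 holomorphic_on ball 0 \<delta>" unfolding g1_def by (rule pole_lemma_open[OF g(1) open_ball])
  have gw: "g w = w * g1 w" for w using g(3) by (simp add: g1_def)
  have g10: "g1 0 = \<mu>" using g(4) by (simp add: g1_def)
  \<comment> \<open>As \<open>g1 0 = \<mu>\<close>, this is \<open>(\<mu> - g1 w) / w\<close> away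
    from \<open>0\<close>, with the removable singularity filled in.\<close>
  define g2 where "g2 w = (if w = 0 then deriv (\<lambda>w. \<mu> - g1 w) 0 else ((\<mu> - g1 w) - (\<mu> - g1 0)) / (w - 0))" for w
  have g2: "g2 holomorphic_on ball 0 \<delta>" unfolding g2_def
    by (rule pole_lemma_open[OF _ open_ball]) (intro holomorphic_intros g1)
  have g2w: "g1 w + w * g2 w = \<mu>" for w using g10 by (simp add: g2_def)
  have "isCont g1 0"
    using holomorphic_on_imp_continuous_on[OF g1] g(2)
    by (auto intro!: continuous_on_interior[of "ball 0 \<delta>"] simp: interior_open)
  then obtain e1 where e1: "e1 > 0" "\<And>w. dist 0 w < e1 \<Longrightarrow> g1 w \<noteq> 0"
    using continuous_at_avoid[of 0 g1 0] g10 g(5) by auto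
  define e2 where "e2 = min e1 \<delta>"
  have e2: "e2 > 0" "e2 \<le> \<delta>" "e2 \<le> e1" using e1 g(2) by (auto simp: e2_def)
  have q: "(\<lambda>w. g2 w / g1 w) holomorphic_on ball 0 e2"
    using e1(2) e2 g1 g2 by (intro holomorphic_on_divide) (auto intro: holomorphic_on_subset)
  obtain H where H: "\<And>w. w \<in> ball 0 e2 \<Longrightarrow> (H has_field_derivative g2 w / g1 w) (at w within ball 0 e2)"
    using holomorphic_convex_primitive'[OF convex_ball open_ball q] by blast
  have H': "(H has_field_derivative g2 w / g1 w) (at w)" if "w \<in> ball 0 e2" for w
    using H[OF that] that by (simp add: at_within_open[OF that open_ball])
  define h where "h w = w * exp (H w)" for w
  have dh: "(h has_field_derivative exp (H w) * (1 + w * (g2 w / g1 w))) (at w)" if "w \<in> ball 0 e2" for w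
    unfolding h_def by (rule derivative_eq_intros H'[OF that] refl)+ (simp add: algebra_simps)
  have hol: "h holomorphic_on ball 0 e2" unfolding holomorphic_on_open[OF open_ball] by (blast intro: dh)
  have "deriv h 0 \<noteq> 0" using DERIV_imp_deriv[OF dh[of 0]] e2 by simp
  have "(0 :: complex) \<in> ball 0 e2" using e2(1) by simp
  obtain e where e: "e > 0" "ball (0 :: complex) e \<subseteq> ball 0 e2" "inj_on h (ball 0 e)"
    by (rule has_complex_derivative_locally_injective[OF hol \<open>(0 :: complex) \<in> ball 0 e2\<close> open_ball \<open>deriv h 0 \<noteq> 0\<close>])
  show ?thesis
  proof (rule that[of "min e e2" h])
    show "h holomorphic_on ball 0 (min e e2)" using hol by (auto intro: holomorphic_on_subset)
    show "inj_on h (ball 0 (min e e2))" using e(3) by (rule inj_on_subset) auto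
    fix w :: complex assume "w \<in> ball 0 (min e e2)"
    then have w: "w \<in> ball 0 e2" by simp
    have nz: "g1 w \<noteq> 0" using e1(2) w e2 by simp
    have "deriv h w * g w = exp (H w) * (w * (g1 w + w * g2 w))"
      unfolding DERIV_imp_deriv[OF dh[OF w]] gw using nz by (simp add: field_simps)
    then show "deriv h w * g w = \<mu> * h w" by (simp add: g2w h_def)
  qed (use e e2 in \<open>auto simp: h_def\<close>)
qed

section \<open>Periodic orbits\<close>

text \<open>Injectivity of \<open>f\<close> turns a period \<open>T'\<close> of the orbit into
  \<open>\<omega> * T' = 2 * pi * n\<close> with an integer \<open>n\<close>; below the claimed
  period this forces \<open>n = 0\<close>.\<close>

lemma least_period_exp:
  fixes f :: "complex \<Rightarrow> 'a"
  assumes inj: "inj_on f (ball 0 r)" and z: "z \<in> ball 0 r" "z \<noteq> 0" and w: "\<omega> \<noteq> 0"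
  shows "least_period (\<lambda>t. f (z * exp (of_real \<omega> * \<i> * of_real t))) (2 * pi / \<bar>\<omega>\<bar>)"
proof -
  let ?T = "2 * pi / \<bar>\<omega>\<bar>"
  have inb: "z * exp (of_real \<omega> * \<i> * of_real t) \<in> ball 0 r" for t
    using z(1) by (simp add: norm_mult)
  \<comment> \<open>The period contains the absolute value of \<open>\<omega>\<close>, so the
    winding number is the sign of \<open>\<omega>\<close>.\<close>
  have "exp (of_real \<omega> * \<i> * of_real ?T) = 1"
    unfolding exp_eq_1 using w by (intro conjI exI[of _ "if \<omega> > 0 then 1 else -1"]) auto
  then have "exp (of_real \<omega> * \<i> * of_real (t + ?T)) = exp (of_real \<omega> * \<i> * of_real t)" for t
    by (simp only: of_real_add distrib_left exp_add) simp
  moreover have "\<not> (\<forall>t. f (z * exp (of_real \<omega> * \<i> * of_real (t + T'))) = f (z * exp (of_real \<omega> * \<i> * of_real t)))"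
    if T': "0 < T'" "T' < ?T" for T'
  proof
    assume "\<forall>t. f (z * exp (of_real \<omega> * \<i> * of_real (t + T'))) = f (z * exp (of_real \<omega> * \<i> * of_real t))"
    from spec[OF this, of 0] have "z * exp (of_real \<omega> * \<i> * of_real (0 + T')) = z * exp (of_real \<omega> * \<i> * of_real 0)"
      by (rule inj_onD[OF inj _ inb inb])
    then have "exp (of_real \<omega> * \<i> * of_real T') = 1" using z(2) by simp
    then obtain n :: int where n: "\<omega> * T' = of_int (2 * n) * pi" unfolding exp_eq_1 by auto
    have "\<bar>\<omega>\<bar> * T' < 2 * pi" using T' w by (simp add: field_simps)
    moreover have "\<bar>\<omega>\<bar> * T' = 2 * pi * of_int \<bar>n\<bar>"
      using arg_cong[OF n, of abs] T' by (simp add: abs_mult)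
    ultimately have "of_int \<bar>n\<bar> < (1 :: real)" by simp
    then have "n = 0" by linarith
    then show False using n w T' by simp
  qed
  ultimately show ?thesis using w unfolding least_period_def by simp
qed

text \<open>The system is autonomous, so the time on an orbit through \<open>y\<close> can be
  shifted to start at \<open>y\<close>.\<close>

lemma periodic_orbit_shift:
  assumes "periodic_orbit F S T C" "y \<in> C"
  obtains x :: "real \<Rightarrow> 'a::real_normed_vector"
  where "\<And>t. x t \<in> C" "\<And>t. (x has_vector_derivative F (x t)) (at t)" "x 0 = y" "x T = y"
proof -
  obtain x where x: "solution_in F S x" "least_period x T" "C = range x"
    using assms(1) by (auto simp: periodic_orbit_def)
  obtain t0 where t0: "y = x t0" using assms(2) x(3) by auto
  show ?thesis
  proof (rule that[of "\<lambda>t. x (t + t0)"])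
    show "x (t + t0) \<in> C" for t using x(3) by simp
    show "((\<lambda>t. x (t + t0)) has_vector_derivative F (x (t + t0))) (at t)" for t
    proof -
      have "(x has_vector_derivative F (x (t + t0))) (at (t + t0))" using x(1) by (simp add: solution_in_def)
      moreover have "((\<lambda>t. t + t0) has_vector_derivative 1) (at t)" by (auto intro!: derivative_eq_intros)
      ultimately show ?thesis using vector_diff_chain_at by (fastforce simp: o_def)
    qed
    show "x (0 + t0) = y" "x (T + t0) = y"
      using x(2) t0 by (simp_all add: least_period_def add.commute[of T])
  qed
qed

subsection \<open>Existence of the invariant disk\<close>

text \<open>Only the multiples \<open>k l\<close> with \<open>k \<ge> 2\<close> are excluded here,
  the ones met by Taylor coefficients beyond the linear one. Simplicity of \<open>l\<close> and the
  remaining integers are assumed where the comparison with another disk calls for them.\<close>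

locale nonresonant_field =
  fixes F :: "complex ^ 'n \<Rightarrow> complex ^ 'n" and R :: real and A :: "complex ^ 'n ^ 'n"
    and l :: complex and v :: "complex ^ 'n"
  assumes R_pos: "R > 0" and hol: "holomorphic_map_on F (ball 0 R)" and F_0: "F 0 = 0"
    and deriv_0: "(F has_derivative (*v) A) (at 0)"
    and l_nonzero: "l \<noteq> 0" and v_nonzero: "v \<noteq> 0" and eigen: "A *v v = l *s v"
    and nonres: "\<And>k. k \<ge> 2 \<Longrightarrow> poly (charpoly A) (of_nat k * l) \<noteq> 0"
begin

text \<open>By strict differentiability \<open>F (q z) - F (p z)\<close> differs from
  \<open>A *v (q z - p z)\<close> by a small multiple of the difference. Hence \<open>F\<close> acts
  on leading coefficients of differences as \<open>A\<close> does, which serves both the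
  construction of Taylor coefficients and their comparison.\<close>

lemma tendsto_scaled_difference:
  assumes "(p \<longlongrightarrow> 0) (at 0)" "(q \<longlongrightarrow> 0) (at 0)"
    and lim: "((\<lambda>z. inverse (z ^ k) *s (q z - p z)) \<longlongrightarrow> e) (at (0 :: complex))"
  shows "((\<lambda>z. inverse (z ^ k) *s (F (q z) - F (p z))) \<longlongrightarrow> A *v e) (at 0)"
proof -
  let ?D = "\<lambda>z. inverse (z ^ k) *s (q z - p z)"
  have AD: "((\<lambda>z. A *v ?D z) \<longlongrightarrow> A *v e) (at 0)"
    by (rule bounded_linear.tendsto[OF matrix_vector_mul_bounded_linear lim])
  have "((\<lambda>z. inverse (z ^ k) *s (F (q z) - F (p z)) - A *v ?D z) \<longlongrightarrow> 0) (at 0)"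
  proof (rule tendstoI)
    fix \<epsilon> :: real assume eps: "\<epsilon> > 0"
    \<comment> \<open>Near \<open>0\<close> the scaled difference has norm below
      \<open>norm e + 1\<close>, so a relative error \<open>\<eta>\<close> stays below
      \<open>\<epsilon>\<close>.\<close>
    define \<eta> where "\<eta> = \<epsilon> / (norm e + 1)"
    have den: "norm e + 1 > 0" using norm_ge_zero[of e] by linarith
    have eta: "\<eta> > 0" using eps den by (simp add: \<eta>_def)
    obtain \<rho> where \<rho>: "\<rho> > 0" "\<rho> \<le> R" "\<And>x y. x \<in> ball 0 \<rho> \<Longrightarrow> y \<in> ball 0 \<rho> \<Longrightarrow>
        norm (F x - F y - A *v (x - y)) \<le> \<eta> * norm (x - y)"
      using holomorphic_map_linear_part[OF hol R_pos F_0 deriv_0 eta] by blast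
    have "\<forall>\<^sub>F z in at 0. p z \<in> ball 0 \<rho>" "\<forall>\<^sub>F z in at 0. q z \<in> ball 0 \<rho>"
      using tendstoD[OF assms(1) \<rho>(1)] tendstoD[OF assms(2) \<rho>(1)] by (auto simp: dist_commute)
    moreover have "\<forall>\<^sub>F z in at 0. norm (?D z) < norm e + 1"
      using tendsto_norm[OF lim] by (rule order_tendstoD) simp
    ultimately show "\<forall>\<^sub>F z in at 0. dist (inverse (z ^ k) *s (F (q z) - F (p z)) - A *v ?D z) 0 < \<epsilon>"
    proof eventually_elim
      case (elim z)
      have "inverse (z ^ k) *s (F (q z) - F (p z)) - A *v ?D z
          = inverse (z ^ k) *s (F (q z) - F (p z) - A *v (q z - p z))"
        unfolding vector_scalar_commute by (simp add: vec_eq_iff right_diff_distrib)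
      then have "norm (inverse (z ^ k) *s (F (q z) - F (p z)) - A *v ?D z)
          = norm (inverse (z ^ k)) * norm (F (q z) - F (p z) - A *v (q z - p z))"
        by (simp only: norm_vector_smult)
      also have "\<dots> \<le> norm (inverse (z ^ k)) * (\<eta> * norm (q z - p z))"
        by (intro mult_left_mono \<rho>(3) elim) auto
      also have "\<dots> = \<eta> * norm (?D z)" by (simp only: norm_vector_smult mult_ac)
      also have "\<dots> < \<eta> * (norm e + 1)" using elim eta by simp
      also have "\<dots> = \<epsilon>" using den by (simp add: \<eta>_def)
      finally show ?case by simp
    qed
  qed
  from tendsto_add[OF this AD] show ?thesis by simp
qed

section \<open>Solutions up to high order\<close>

definition residual :: "(complex \<Rightarrow> complex ^ 'n) \<Rightarrow> complex \<Rightarrow> complex ^ 'n" where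
  "residual p z = F (p z) - (l * z) *s vderiv p z"

lemma vholomorphic_residual:
  assumes "vholomorphic_on p S" "open S" "p ` S \<subseteq> ball 0 R"
  shows "vholomorphic_on (residual p) S"
proof -
  have 1: "(\<lambda>z. F (p z) $ i) holomorphic_on S" for i
    using vholomorphic_compose_map[OF hol open_ball assms] by (simp add: vholomorphic_on_def)
  have 2: "deriv (\<lambda>w. p w $ i) holomorphic_on S" for i
    using assms(1,2) by (intro holomorphic_deriv) (auto simp: vholomorphic_on_def)
  have "(\<lambda>z. F (p z) $ i - l * z * deriv (\<lambda>w. p w $ i) z) holomorphic_on S" for i
    by (intro holomorphic_on_diff holomorphic_on_mult holomorphic_on_const holomorphic_on_ident 1 2)
  then show ?thesis
    unfolding vholomorphic_on_def residual_def by (simp add: vderiv_nth)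
qed

text \<open>If the residual begins with coefficient \<open>c\<close> at order \<open>k\<close>,
  adding \<open>z ^ k *s e\<close> changes this coefficient by \<open>A *v e - (k l) *s e\<close>.
  Nonresonance provides an \<open>e\<close> for which the sum vanishes, and \<open>k \<ge> 2\<close>
  keeps the value and the derivative at \<open>0\<close>.\<close>

lemma approximate_solution:
  "\<exists>p. vholomorphic_on p UNIV \<and> p 0 = 0 \<and> vderiv p 0 = v \<and>
     ((\<lambda>z. inverse (z ^ Suc m) *s residual p z) \<longlongrightarrow> 0) (at 0)"
proof (induction m)
  case 0
  \<comment> \<open>Start with \<open>z *s v\<close>: its residual divided by \<open>z\<close> tends
    to \<open>A *v v - l *s v\<close>, which is zero.\<close>
  have 1: "vholomorphic_on (\<lambda>z. 0 :: complex ^ 'n) UNIV" by (simp add: vholomorphic_on_def)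
  have 2: "vderiv (\<lambda>z. 0 :: complex ^ 'n) z = 0" for z by (simp add: vderiv_def vec_eq_iff)
  have d: "((\<lambda>z. z *s v) has_derivative (\<lambda>h. h *s v)) (at z)" for z
    using has_derivative_add_monomial[OF 1, of 1 v z] 2 by simp
  have hp: "vholomorphic_on (\<lambda>z. z *s v) UNIV" by (rule vholomorphic_onI[OF d])
  have vd: "vderiv (\<lambda>z. z *s v) z = v" for z by (rule has_derivative_imp_vderiv(2)[OF d])
  have "isCont (\<lambda>z. z *s v) 0" using has_derivative_continuous[OF d] .
  then have "((\<lambda>z. z *s v) \<longlongrightarrow> 0) (at 0)" by (simp add: isCont_def)
  moreover have "((\<lambda>z. inverse (z ^ 1) *s (z *s v - 0)) \<longlongrightarrow> v) (at 0)"
    by (rule Lim_transform_eventually[OF tendsto_const]) (auto simp: eventually_at_filter)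
  ultimately have "((\<lambda>z. inverse (z ^ 1) *s (F (z *s v) - F 0)) \<longlongrightarrow> A *v v) (at 0)"
    by (intro tendsto_scaled_difference) auto
  then have "((\<lambda>z. inverse (z ^ 1) *s (F (z *s v) - F 0) - l *s v) \<longlongrightarrow> A *v v - l *s v) (at 0)"
    by (intro tendsto_intros)
  then have "((\<lambda>z. inverse (z ^ Suc 0) *s residual (\<lambda>z. z *s v) z) \<longlongrightarrow> A *v v - l *s v) (at 0)"
    by (rule Lim_transform_eventually)
       (auto simp: eventually_at_filter residual_def vd F_0 vec_eq_iff right_diff_distrib)
  then show ?case using hp vd by (intro exI[of _ "\<lambda>z. z *s v"]) (simp add: eigen)
next
  case (Suc m)
  then obtain p where p: "vholomorphic_on p UNIV" "p 0 = 0" "vderiv p 0 = v"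
    "((\<lambda>z. inverse (z ^ Suc m) *s residual p z) \<longlongrightarrow> 0) (at 0)" by blast
  \<comment> \<open>The residual is already of smaller order than \<open>z ^ Suc m\<close>, so this
    is the next order to correct; it is at least 2, as \<open>nonres\<close> demands.\<close>
  let ?k = "Suc (Suc m)"
  have "vholomorphic_on p (ball 0 1)" by (rule vholomorphic_on_subset[OF p(1)]) simp
  then obtain d where d: "d > 0" "d \<le> 1" "p ` ball 0 d \<subseteq> ball 0 R"
    using vholomorphic_small_ball[of p 1 R] p(2) R_pos zero_less_one by blast
  have "vholomorphic_on (residual p) (ball 0 d)"
    by (rule vholomorphic_residual[OF vholomorphic_on_subset[OF p(1)]]) (use d in auto)
  from vholomorphic_order_step[OF this d(1) p(4)]
  obtain c where c: "((\<lambda>z. inverse (z ^ ?k) *s residual p z) \<longlongrightarrow> c) (at 0)" by blast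
  obtain e where e: "(of_nat ?k * l) *s e - A *v e = c"
    using resolvent_surj[OF nonres[of ?k]] by auto
  define q where "q = (\<lambda>z. p z + z ^ ?k *s e)"
  note dq = has_derivative_add_monomial[OF p(1), of ?k e, folded q_def]
  have q: "vholomorphic_on q UNIV" "\<And>z. vderiv q z = vderiv p z + (of_nat ?k * z ^ (?k - 1)) *s e"
    by (rule vholomorphic_onI[OF dq], rule has_derivative_imp_vderiv(2)[OF dq])
  have "isCont p 0" "isCont q 0"
    using vholomorphic_imp_continuous_on[OF p(1)] vholomorphic_imp_continuous_on[OF q(1)]
    by (auto simp: continuous_on_eq_continuous_at)
  then have "(p \<longlongrightarrow> 0) (at 0)" "(q \<longlongrightarrow> 0) (at 0)" using p(2) by (auto simp: isCont_def q_def)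
  moreover have "((\<lambda>z. inverse (z ^ ?k) *s (q z - p z)) \<longlongrightarrow> e) (at 0)"
    by (rule Lim_transform_eventually[OF tendsto_const])
       (auto simp: eventually_at_filter q_def simp del: power_Suc)
  ultimately have lF: "((\<lambda>z. inverse (z ^ ?k) *s (F (q z) - F (p z))) \<longlongrightarrow> A *v e) (at 0)"
    by (rule tendsto_scaled_difference)
  have z0: "A *v e + c - (of_nat ?k * l) *s e = 0" by (simp only: e[symmetric]) simp
  from tendsto_diff[OF tendsto_add[OF lF c] tendsto_const[of "(of_nat ?k * l) *s e"]]
  have "((\<lambda>z. inverse (z ^ ?k) *s (F (q z) - F (p z)) + inverse (z ^ ?k) *s residual p z
      - (of_nat ?k * l) *s e) \<longlongrightarrow> 0) (at 0)"
    unfolding z0 .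
  note l0 = this
  have eq: "inverse (z ^ ?k) *s (F (q z) - F (p z)) + inverse (z ^ ?k) *s residual p z
      - (of_nat ?k * l) *s e = inverse (z ^ ?k) *s residual q z" if "z \<noteq> 0" for z
    using that by (simp add: residual_def q vec_eq_iff field_simps)
  have "((\<lambda>z. inverse (z ^ ?k) *s residual q z) \<longlongrightarrow> 0) (at 0)"
    by (rule Lim_transform_eventually[OF l0]) (intro eventually_at_filter[THEN iffD2] always_eventually impI allI eq)
  then show ?case
    using q p by (intro exI[of _ q]) (auto simp: q_def)
qed

section \<open>Picard iteration in the weight \<open>norm z ^ m\<close>\<close>

text \<open>Along the segment \<open>t * z\<close> the derivative of the difference is bounded by
  \<open>B / norm l * norm z ^ m * t ^ (m - 1)\<close>. Integration over \<open>t\<close> yields the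
  factor \<open>1 / m\<close> that makes the iteration contract for large \<open>m\<close>.\<close>

lemma difference_bound:
  assumes f: "vholomorphic_on f (ball 0 \<delta>)" and g: "vholomorphic_on g (ball 0 \<delta>)" and fg0: "f 0 = g 0"
    and m: "m > 0" and z: "z \<in> ball 0 \<delta>"
    and bd: "\<And>w. w \<in> ball 0 \<delta> \<Longrightarrow> w \<noteq> 0 \<Longrightarrow>
      norm ((l * w) *s vderiv f w - (l * w) *s vderiv g w) \<le> B * norm w ^ m"
  shows "norm (f z - g z) \<le> B / (real m * norm l) * norm z ^ m"
proof (cases "z = 0")
  case False
  define u where "u t = of_real t * z" for t :: real
  have u: "u t \<in> ball 0 \<delta>" if "0 \<le> t" "t \<le> 1" for t
    using z that mult_left_le_one_le[of "norm z" t] by (auto simp: u_def norm_mult)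
  have du: "(u has_vector_derivative z) (at t)" for t
    unfolding u_def by (auto intro!: derivative_eq_intros)
  have dfg: "((\<lambda>t. f (u t) - g (u t)) has_vector_derivative
      z *s vderiv f (u t) - z *s vderiv g (u t)) (at t)" if "0 \<le> t" "t \<le> 1" for t
    by (intro has_vector_derivative_diff vholomorphic_curve[OF f open_ball u du]
        vholomorphic_curve[OF g open_ball u du] that)
  have "norm ((f (u 1) - g (u 1)) - (f (u 0) - g (u 0)))
      \<le> B / (real m * norm l) * norm z ^ m * 1 ^ m - B / (real m * norm l) * norm z ^ m * 0 ^ m"
  proof (rule differentiable_bound_general[where a = 0 and b = 1 and f = "\<lambda>t. f (u t) - g (u t)"
        and \<phi> = "\<lambda>t. B / (real m * norm l) * norm z ^ m * t ^ m"
        and \<phi>' = "\<lambda>t. B / norm l * norm z ^ m * t ^ (m - 1)"])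
    show "continuous_on {0..1} (\<lambda>t. f (u t) - g (u t))"
      by (intro continuous_at_imp_continuous_on ballI has_vector_derivative_continuous[OF dfg]) auto
    show "continuous_on {0..1} (\<lambda>t. B / (real m * norm l) * norm z ^ m * t ^ m)"
      by (intro continuous_intros)
    fix t :: real assume t: "0 < t" "t < 1"
    show "((\<lambda>t. f (u t) - g (u t)) has_vector_derivative z *s vderiv f (u t) - z *s vderiv g (u t)) (at t)"
      using dfg t by simp
    have "((\<lambda>t. B / (real m * norm l) * norm z ^ m * t ^ m) has_real_derivative
        B / (real m * norm l) * norm z ^ m * (real m * t ^ (m - 1))) (at t)"
      using m l_nonzero by (auto intro!: derivative_eq_intros)
    also have "B / (real m * norm l) * norm z ^ m * (real m * t ^ (m - 1)) = B / norm l * norm z ^ m * t ^ (m - 1)"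
      using m l_nonzero by (simp add: field_simps)
    finally show "((\<lambda>t. B / (real m * norm l) * norm z ^ m * t ^ m) has_vector_derivative
        B / norm l * norm z ^ m * t ^ (m - 1)) (at t)"
      by (rule has_real_derivative_iff_has_vector_derivative[THEN iffD1])
    have tm: "t ^ m = t * t ^ (m - 1)" using m by (cases m) auto
    have "norm l * t * norm (z *s vderiv f (u t) - z *s vderiv g (u t))
        = norm ((l * u t) *s vderiv f (u t) - (l * u t) *s vderiv g (u t))"
    proof -
      have "(l * u t) *s vderiv f (u t) - (l * u t) *s vderiv g (u t)
          = (l * of_real t) *s (z *s vderiv f (u t) - z *s vderiv g (u t))"
        by (simp add: u_def vec_eq_iff algebra_simps)
      then show ?thesis using t by (simp only: norm_vector_smult norm_mult norm_of_real abs_of_pos)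
    qed
    also have "\<dots> \<le> B * norm (u t) ^ m"
      using t u[of t] False by (intro bd) (auto simp: u_def)
    also have "\<dots> = t * (B * norm z ^ m * t ^ (m - 1))"
      using t by (simp add: u_def norm_mult power_mult_distrib tm)
    finally have "norm l * norm (z *s vderiv f (u t) - z *s vderiv g (u t)) \<le> B * norm z ^ m * t ^ (m - 1)"
      using t(1) by (simp add: mult.assoc mult.left_commute[of "norm l" t])
    then show "norm (z *s vderiv f (u t) - z *s vderiv g (u t)) \<le> B / norm l * norm z ^ m * t ^ (m - 1)"
      using l_nonzero by (simp add: field_simps)
  qed auto
  then show ?thesis using m fg0 by (simp add: u_def zero_power)
qed (use m fg0 in \<open>simp add: zero_power\<close>)

text \<open>As \<open>F (f 0) = 0\<close>, the quotient \<open>F (f z) / z\<close> extends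
  holomorphically over \<open>0\<close>; the next iterate is its primitive divided by
  \<open>l\<close>.\<close>

lemma picard_step:
  assumes f: "vholomorphic_on f (ball 0 \<delta>)" "f ` ball 0 \<delta> \<subseteq> ball 0 R" "f 0 = 0"
  obtains g where "vholomorphic_on g (ball 0 \<delta>)" "g 0 = 0"
    "\<And>z. z \<in> ball 0 \<delta> \<Longrightarrow> (l * z) *s vderiv g z = F (f z)"
proof -
  define h where "h i z = F (f z) $ i" for i z
  define k where "k i z = (if z = 0 then deriv (h i) 0 else (h i z - h i 0) / (z - 0))" for i z
  have h0: "h i 0 = 0" for i by (simp add: h_def f(3) F_0)
  have h: "h i holomorphic_on ball 0 \<delta>" for i
    using vholomorphic_compose_map[OF hol open_ball f(1) open_ball f(2)]
    unfolding vholomorphic_on_def h_def by simp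
  have k: "k i holomorphic_on ball 0 \<delta>" for i
    unfolding k_def by (rule pole_lemma_open[OF h open_ball])
  have "\<exists>G. \<forall>z\<in>ball 0 \<delta>. (G has_field_derivative k i z) (at z)" for i
    using holomorphic_convex_primitive'[OF convex_ball open_ball k, of i] by (metis at_within_open open_ball)
  then obtain G where G: "\<And>i z. z \<in> ball 0 \<delta> \<Longrightarrow> (G i has_field_derivative k i z) (at z)"
    by metis
  define g where "g z = (\<chi> i. (G i z - G i 0) / l)" for z
  have dg: "(g has_derivative (\<lambda>w. w *s (\<chi> i. k i z / l))) (at z)" if "z \<in> ball 0 \<delta>" for z
    unfolding has_derivative_vec_iff
  proof
    fix i
    have "((\<lambda>z. (G i z - G i 0) / l) has_field_derivative k i z / l) (at z)"
      using l_nonzero by (auto intro!: derivative_eq_intros G[OF that])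
    moreover have "(\<lambda>h. (h *s (\<chi> i. k i z / l)) $ i) = (*) (k i z / l)"
      by (auto simp: fun_eq_iff)
    ultimately show "((\<lambda>x. g x $ i) has_derivative (\<lambda>h. (h *s (\<chi> i. k i z / l)) $ i)) (at z)"
      by (simp add: has_field_derivative_def g_def)
  qed
  show ?thesis
  proof (rule that[of g])
    show "vholomorphic_on g (ball 0 \<delta>)" by (rule vholomorphic_onI[OF dg])
    show "g 0 = 0" by (simp add: g_def vec_eq_iff)
    show "(l * z) *s vderiv g z = F (f z)" if "z \<in> ball 0 \<delta>" for z
    proof -
      have "z * k i z = h i z" for i using h0 by (simp add: k_def)
      then show ?thesis
        unfolding has_derivative_imp_vderiv(2)[OF dg[OF that]]
        using l_nonzero by (simp add: vec_eq_iff h_def)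
    qed
  qed
qed

text \<open>The start \<open>p\<close> has residual at most \<open>norm z ^ m\<close>. Each step at
  least halves the weighted distance of successive iterates, so they stay within
  \<open>2 * K * norm z ^ m\<close> of \<open>p\<close> and converge uniformly.\<close>

lemma invariant_disk:
  obtains f \<delta> where "\<delta> > 0" "vholomorphic_on f (ball 0 \<delta>)" "f ` ball 0 \<delta> \<subseteq> ball 0 R" "f 0 = 0"
    "vderiv f 0 = v" "\<And>z. z \<in> ball 0 \<delta> \<Longrightarrow> (l * z) *s vderiv f z = F (f z)"
proof -
  obtain \<rho> where \<rho>: "\<rho> > 0" "\<rho> \<le> R" and lin: "\<And>x y. x \<in> ball 0 \<rho> \<Longrightarrow> y \<in> ball 0 \<rho> \<Longrightarrow>
      norm (F x - F y - A *v (x - y)) \<le> 1 * norm (x - y)"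
    using holomorphic_map_linear_part[OF hol R_pos F_0 deriv_0 zero_less_one] by blast
  have blA: "bounded_linear ((*v) A)" by (rule matrix_vector_mul_bounded_linear)
  define L where "L = onorm ((*v) A) + 1"
  have L: "L > 0" using onorm_pos_le[OF blA] by (simp add: L_def)
  have lip: "norm (F x - F y) \<le> L * norm (x - y)" if "x \<in> ball 0 \<rho>" "y \<in> ball 0 \<rho>" for x y
  proof -
    have "norm (F x - F y) \<le> norm (F x - F y - A *v (x - y)) + norm (A *v (x - y))"
      by (metis norm_triangle_sub add.commute)
    also have "\<dots> \<le> 1 * norm (x - y) + onorm ((*v) A) * norm (x - y)"
      by (intro add_mono lin that onorm[OF blA])
    finally show ?thesis by (simp add: L_def algebra_simps)
  qed
  \<comment> \<open>The gain \<open>1 / m\<close> has to outweigh the Lipschitz constant: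
    \<open>L / (m * norm l)\<close> must be at most \<open>1 / 2\<close>.\<close>
  obtain m0 :: nat where m0: "2 * L / norm l \<le> real m0" using real_arch_simple by blast
  \<comment> \<open>With \<open>m \<ge> 2\<close> a perturbation of order \<open>z ^ m\<close>
    leaves the derivative at \<open>0\<close> unchanged.\<close>
  define m where "m = Suc (Suc m0)"
  have nl: "norm l > 0" using l_nonzero by simp
  have "2 * L / norm l \<le> real m" using m0 by (simp add: m_def)
  then have "2 * L \<le> real m * norm l" using nl by (simp only: pos_divide_le_eq)
  moreover have "real m * norm l > 0" using nl by (simp add: m_def)
  ultimately have mL: "L / (real m * norm l) \<le> 1 / 2" by (simp only: pos_divide_le_eq)
  \<comment> \<open>The constant of \<open>difference_bound\<close> for \<open>B = 1\<close>; it
    controls the first correction \<open>T p - p\<close>.\<close>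
  define K where "K = 1 / (real m * norm l)"
  have K: "K > 0" using nl by (simp add: K_def m_def)
  obtain p where p: "vholomorphic_on p UNIV" "p 0 = 0" "vderiv p 0 = v"
      "((\<lambda>z. inverse (z ^ m) *s residual p z) \<longlongrightarrow> 0) (at 0)"
    using approximate_solution[of "Suc m0"] unfolding m_def by blast
  obtain d1 where d1: "d1 > 0" "\<And>z. z \<noteq> 0 \<Longrightarrow> dist z 0 < d1 \<Longrightarrow> dist (inverse (z ^ m) *s residual p z) 0 < 1"
    using tendstoD[OF p(4) zero_less_one] unfolding eventually_at by auto
  have res: "norm (residual p z) \<le> norm z ^ m" if "z \<noteq> 0" "norm z < d1" for z
  proof -
    have "inverse (norm z ^ m) * norm (residual p z) < 1"
      using d1(2)[of z] that by (simp add: norm_vector_smult norm_inverse norm_power)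
    then show ?thesis using that(1) by (simp add: field_simps)
  qed
  have p1: "vholomorphic_on p (ball 0 1)" by (rule vholomorphic_on_subset[OF p(1)]) simp
  have "\<rho> / 2 > 0" using \<rho> by simp
  then obtain d2 where d2: "d2 > 0" "d2 \<le> 1" "p ` ball 0 d2 \<subseteq> ball 0 (\<rho> / 2)"
    using vholomorphic_small_ball[of p 1 "\<rho> / 2"] p1 p(2) zero_less_one by blast
  \<comment> \<open>\<open>d1\<close> gives the residual bound, \<open>d2\<close> keeps
    \<open>p\<close> in the ball of radius \<open>\<rho> / 2\<close>, and the last entry leaves the
    other half of \<open>\<rho>\<close> for a deviation of \<open>2 * K * norm z\<close>.\<close>
  define \<delta> where "\<delta> = min (min d1 d2) (\<rho> / (4 * K))"
  have \<delta>: "\<delta> > 0" "\<delta> \<le> d1" "\<delta> \<le> d2" "\<delta> \<le> 1" "\<delta> \<le> \<rho> / (4 * K)"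
    using d1 d2 \<rho> K by (auto simp: \<delta>_def)
  let ?B = "ball (0 :: complex) \<delta>"
  have zm: "norm z ^ m \<le> norm z" "norm z ^ m \<le> 1" if "z \<in> ?B" for z
    using that \<delta>(4) power_decreasing[of 1 m "norm z"] by (auto simp: m_def power_le_one)
  have small: "f z \<in> ball 0 \<rho>" if "norm (f z - p z) \<le> 2 * K * norm z ^ m" "z \<in> ?B" for f z
  proof -
    have "norm (f z) \<le> norm (p z) + norm (f z - p z)" by (rule norm_triangle_sub)
    also have "\<dots> \<le> norm (p z) + 2 * K * norm z"
      using that zm(1)[OF that(2)] K by (auto intro: order_trans mult_left_mono)
    also have "\<dots> < \<rho> / 2 + 2 * K * (\<rho> / (4 * K))"
    proof (rule add_strict_mono)
      show "norm (p z) < \<rho> / 2" using d2(3) that(2) \<delta>(3) by (auto simp: image_subset_iff)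
      show "2 * K * norm z < 2 * K * (\<rho> / (4 * K))"
        using that(2) \<delta>(5) K by (intro mult_strict_left_mono) auto
    qed
    also have "\<dots> = \<rho>" using K by simp
    finally show ?thesis by simp
  qed
  have pB: "vholomorphic_on p ?B" by (rule vholomorphic_on_subset[OF p(1)]) simp
  define T where "T f = (SOME g. vholomorphic_on g ?B \<and> g 0 = 0 \<and> (\<forall>z\<in>?B. (l * z) *s vderiv g z = F (f z)))" for f
  have T: "vholomorphic_on (T f) ?B \<and> T f 0 = 0 \<and> (\<forall>z\<in>?B. (l * z) *s vderiv (T f) z = F (f z))"
    if "vholomorphic_on f ?B" "f 0 = 0" "\<And>z. z \<in> ?B \<Longrightarrow> f z \<in> ball 0 \<rho>" for f
  proof -
    have sub: "f ` ?B \<subseteq> ball 0 R" using that(3) subset_ball[OF \<rho>(2)] by blast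
    have "\<exists>g. vholomorphic_on g ?B \<and> g 0 = 0 \<and> (\<forall>z\<in>?B. (l * z) *s vderiv g z = F (f z))"
      by (rule picard_step[where f = f and \<delta> = \<delta>, OF that(1) sub that(2)]) (intro exI conjI ballI)
    then show ?thesis unfolding T_def by (rule someI_ex)
  qed
  define s where "s n = (T ^^ n) p" for n
  have s_Suc: "s (Suc n) = T (s n)" for n by (simp add: s_def)
  \<comment> \<open>\<open>2 * K * (1 - (1/2) ^ n)\<close> is the sum of the first \<open>n\<close>
    step bounds \<open>K * (1/2) ^ j\<close>. It keeps every iterate in the ball of radius
    \<open>\<rho>\<close>, where \<open>lip\<close> applies.\<close>
  have step: "vholomorphic_on (s n) ?B \<and> s n 0 = 0 \<and>
      (\<forall>z\<in>?B. norm (s n z - p z) \<le> 2 * K * (1 - (1/2) ^ n) * norm z ^ m) \<and>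
      (\<forall>z\<in>?B. norm (s (Suc n) z - s n z) \<le> K * (1/2) ^ n * norm z ^ m)" for n
  proof (induction n)
    case 0
    have Tp: "vholomorphic_on (T p) ?B \<and> T p 0 = 0 \<and> (\<forall>z\<in>?B. (l * z) *s vderiv (T p) z = F (p z))"
      using small[of p] K by (intro T pB p(2)) auto
    have "norm (T p z - p z) \<le> 1 / (real m * norm l) * norm z ^ m" if "z \<in> ?B" for z
    proof (rule difference_bound[OF _ pB _ _ that])
      fix w assume w: "w \<in> ?B" "w \<noteq> 0"
      then show "norm ((l * w) *s vderiv (T p) w - (l * w) *s vderiv p w) \<le> 1 * norm w ^ m"
        using Tp res[of w] \<delta>(2) by (simp add: residual_def)
    qed (use Tp p(2) m_def in auto)
    then show ?case using pB p(2) by (auto simp: s_def K_def)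
  next
    case (Suc n)
    have close: "norm (s n z - p z) \<le> 2 * K * norm z ^ m" if "z \<in> ?B" for z
    proof -
      have "norm (s n z - p z) \<le> 2 * K * (1 - (1/2) ^ n) * norm z ^ m" using Suc that by blast
      also have "\<dots> \<le> 2 * K * 1 * norm z ^ m"
        using K by (intro mult_right_mono mult_left_mono) auto
      finally show ?thesis by simp
    qed
    have Tn: "vholomorphic_on (s (Suc n)) ?B \<and> s (Suc n) 0 = 0 \<and> (\<forall>z\<in>?B. (l * z) *s vderiv (s (Suc n)) z = F (s n z))"
      unfolding s_Suc by (rule T) (use Suc small close in auto)
    have near: "norm (s (Suc n) z - p z) \<le> 2 * K * (1 - (1/2) ^ Suc n) * norm z ^ m" if "z \<in> ?B" for z
    proof -
      have "norm (s (Suc n) z - p z) \<le> norm (s (Suc n) z - s n z) + norm (s n z - p z)"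
        using norm_triangle_ineq[of "s (Suc n) z - s n z" "s n z - p z"] by simp
      also have "\<dots> \<le> K * (1/2) ^ n * norm z ^ m + 2 * K * (1 - (1/2) ^ n) * norm z ^ m"
        using Suc that by (intro add_mono) blast+
      also have "\<dots> = 2 * K * (1 - (1/2) ^ Suc n) * norm z ^ m" by (simp add: algebra_simps)
      finally show ?thesis .
    qed
    have close': "norm (s (Suc n) z - p z) \<le> 2 * K * norm z ^ m" if "z \<in> ?B" for z
    proof -
      have "2 * K * (1 - (1/2) ^ Suc n) * norm z ^ m \<le> 2 * K * 1 * norm z ^ m"
        using K by (intro mult_right_mono mult_left_mono) auto
      with near[OF that] show ?thesis by simp
    qed
    have Tn': "vholomorphic_on (s (Suc (Suc n))) ?B \<and> s (Suc (Suc n)) 0 = 0 \<and>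
        (\<forall>z\<in>?B. (l * z) *s vderiv (s (Suc (Suc n))) z = F (s (Suc n) z))"
      unfolding s_Suc[of "Suc n"] by (rule T) (use Tn small close' in auto)
    have "norm (s (Suc (Suc n)) z - s (Suc n) z) \<le> K * (1/2) ^ Suc n * norm z ^ m" if z: "z \<in> ?B" for z
    proof -
      have "norm (s (Suc (Suc n)) z - s (Suc n) z) \<le> L * (K * (1/2) ^ n) / (real m * norm l) * norm z ^ m"
      proof (rule difference_bound[OF _ _ _ _ z])
        fix w assume w: "w \<in> ?B" "w \<noteq> 0"
        have "norm (F (s (Suc n) w) - F (s n w)) \<le> L * norm (s (Suc n) w - s n w)"
          using w by (intro lip small close close')
        also have "\<dots> \<le> L * (K * (1/2) ^ n * norm w ^ m)"
          using Suc w L by (intro mult_left_mono) auto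
        finally show "norm ((l * w) *s vderiv (s (Suc (Suc n))) w - (l * w) *s vderiv (s (Suc n)) w)
            \<le> L * (K * (1/2) ^ n) * norm w ^ m"
          using Tn Tn' w by (simp add: mult.assoc)
      qed (use Tn Tn' m_def in auto)
      also have "L * (K * (1/2) ^ n) / (real m * norm l) = L / (real m * norm l) * (K * (1/2) ^ n)" by simp
      also have "\<dots> * norm z ^ m \<le> 1/2 * (K * (1/2) ^ n) * norm z ^ m"
        using K by (intro mult_right_mono mL) auto
      finally show ?thesis by (simp add: mult_ac)
    qed
    then show ?case using Tn near by blast
  qed
  \<comment> \<open>The iterates become partial sums of a telescoping series, to which the
    Weierstrass test applies.\<close>
  define d where "d n z = s (Suc n) z - s n z" for n z
  define f where "f z = p z + suminf (\<lambda>n. d n z)" for z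
  have sum: "p z + (\<Sum>i<n. d i z) = s n z" for n z
    unfolding d_def sum_lessThan_telescope[of "\<lambda>n. s n z" n] by (simp add: s_def)
  have "uniform_limit ?B (\<lambda>n z. \<Sum>i<n. d i z) (\<lambda>z. suminf (\<lambda>n. d n z)) sequentially"
  proof (rule Weierstrass_m_test)
    fix n z assume z: "z \<in> ?B"
    have "norm (d n z) \<le> K * (1/2) ^ n * norm z ^ m" using step z by (simp add: d_def)
    also have "\<dots> \<le> K * (1/2) ^ n * 1" using zm(2)[OF z] K by (intro mult_left_mono) auto
    finally show "norm (d n z) \<le> K * (1/2) ^ n" by simp
  next
    show "summable (\<lambda>n. K * (1/2 :: real) ^ n)" by (intro summable_mult summable_geometric) simp
  qed
  from uniform_limit_add[OF uniform_limit_const[where c = p] this]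
  have ul: "uniform_limit ?B s f sequentially" unfolding sum f_def[symmetric] .
  have sh: "((\<lambda>z. s n z $ i) has_field_derivative vderiv (s n) z $ i) (at z)" if "z \<in> ?B" for n i z
    by (rule vholomorphic_has_field_derivative[OF _ open_ball that]) (use step in blast)
  \<comment> \<open>Locally uniform convergence of holomorphic functions carries the derivatives
    along; this lets the differential equation pass to the limit.\<close>
  have "\<exists>g'. \<forall>z\<in>?B. ((\<lambda>z. f z $ i) has_field_derivative g' z) (at z) \<and> (\<lambda>n. vderiv (s n) z $ i) \<longlonglongrightarrow> g' z" for i
  proof (rule has_complex_derivative_uniform_sequence[OF open_ball sh])
    fix z assume "z \<in> ?B"
    then obtain e where "e > 0" "cball z e \<subseteq> ?B" using open_ball open_contains_cball by metis
    moreover have "uniform_limit (cball z e) (\<lambda>n z. s n z $ i) (\<lambda>z. f z $ i) sequentially"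
      by (rule bounded_linear.uniform_limit[OF bounded_linear_vec_nth uniform_limit_on_subset[OF ul calculation(2)]])
    ultimately show "\<exists>e>0. cball z e \<subseteq> ?B \<and> uniform_limit (cball z e) (\<lambda>n z. s n z $ i) (\<lambda>z. f z $ i) sequentially"
      by blast
  qed
  then obtain g' where g': "\<And>i z. z \<in> ?B \<Longrightarrow> ((\<lambda>z. f z $ i) has_field_derivative g' i z) (at z)"
      "\<And>i z. z \<in> ?B \<Longrightarrow> (\<lambda>n. vderiv (s n) z $ i) \<longlonglongrightarrow> g' i z" by metis
  have f: "vholomorphic_on f ?B"
    unfolding vholomorphic_on_def holomorphic_on_open[OF open_ball] by (blast intro: g'(1))
  have vf: "vderiv f z $ i = g' i z" if "z \<in> ?B" for z i
    unfolding vderiv_nth by (rule DERIV_imp_deriv[OF g'(1)[OF that]])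
  have slim: "(\<lambda>n. s n z) \<longlonglongrightarrow> f z" if "z \<in> ?B" for z
    by (rule tendsto_uniform_limitI[OF ul that])
  have fp: "norm (f z - p z) \<le> 2 * K * norm z ^ m" if z: "z \<in> ?B" for z
  proof (rule LIMSEQ_le_const2)
    show "(\<lambda>n. norm (s n z - p z)) \<longlonglongrightarrow> norm (f z - p z)" by (intro tendsto_intros slim z)
    have "norm (s n z - p z) \<le> 2 * K * norm z ^ m" for n
    proof -
      have "norm (s n z - p z) \<le> 2 * K * (1 - (1/2) ^ n) * norm z ^ m" using step z by blast
      also have "\<dots> \<le> 2 * K * 1 * norm z ^ m"
        using K by (intro mult_right_mono mult_left_mono) auto
      finally show ?thesis by simp
    qed
    then show "\<exists>N. \<forall>n\<ge>N. norm (s n z - p z) \<le> 2 * K * norm z ^ m" by blast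
  qed
  have fR: "f z \<in> ball 0 R" if "z \<in> ?B" for z
    using small[of f z] fp[OF that] that \<rho>(2) by simp
  have f0: "f 0 = 0" using fp[of 0] \<delta>(1) p(2) by (simp add: m_def)
  show ?thesis
  proof (rule that[OF \<delta>(1) f _ f0])
    show "f ` ?B \<subseteq> ball 0 R" using fR by blast
    \<comment> \<open>Since \<open>m \<ge> 2\<close> and \<open>norm z < 1\<close>, \<open>f\<close>
      and \<open>p\<close> differ by at most \<open>2 * K * norm z ^ 2\<close>.\<close>
    show "vderiv f 0 = v"
    proof (rule vec_eq_iff[THEN iffD2], rule allI)
      fix i
      have "0 \<in> ?B" using \<delta>(1) by simp
      then have "((\<lambda>z. f z $ i - p z $ i) has_field_derivative (vderiv f 0 $ i - vderiv p 0 $ i)) (at 0)"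
        by (intro derivative_intros vholomorphic_has_field_derivative[OF f]
            vholomorphic_has_field_derivative[OF pB]) auto
      then have 1: "((\<lambda>z. (f z $ i - p z $ i) / z) \<longlongrightarrow> vderiv f 0 $ i - vderiv p 0 $ i) (at 0)"
        using f0 p(2) by (simp add: has_field_derivative_iff)
      have "((\<lambda>z::complex. 2 * K * norm z) \<longlongrightarrow> 2 * K * norm (0 :: complex)) (at 0)"
        by (intro tendsto_mult tendsto_const tendsto_norm tendsto_ident_at)
      then have 2: "((\<lambda>z::complex. 2 * K * norm z) \<longlongrightarrow> 0) (at 0)" by simp
      have "((\<lambda>z. (f z $ i - p z $ i) / z) \<longlongrightarrow> 0) (at 0)"
      proof (rule Lim_null_comparison[OF _ 2])
        have "norm ((f z $ i - p z $ i) / z) \<le> 2 * K * norm z" if z: "z \<noteq> 0" "dist z 0 < \<delta>" for z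
        proof -
          have "norm (f z $ i - p z $ i) \<le> 2 * K * norm z ^ m"
            using fp[of z] z Finite_Cartesian_Product.norm_nth_le[of "f z - p z" i] by simp
          also have "\<dots> \<le> 2 * K * norm z ^ 2"
            using z \<delta>(4) K by (intro mult_left_mono power_decreasing) (auto simp: m_def)
          finally show ?thesis using z by (simp add: norm_divide field_simps power2_eq_square)
        qed
        then show "\<forall>\<^sub>F z in at 0. norm ((f z $ i - p z $ i) / z) \<le> 2 * K * norm z"
          unfolding eventually_at using \<delta>(1) by blast
      qed
      from LIM_unique[OF 1 this] show "vderiv f 0 $ i = v $ i" using p(3) by simp
    qed
    fix z assume z: "z \<in> ?B"
    \<comment> \<open>Both sides are limits of the common value
      \<open>(l * z) *s vderiv (s (Suc n)) z = F (s n z)\<close>.\<close>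
    show "(l * z) *s vderiv f z = F (f z)"
    proof (rule LIMSEQ_unique)
      obtain D where "(F has_derivative (*v) D) (at (f z))"
        using holomorphic_map_derivative[OF hol open_ball fR[OF z]] by blast
      then have "isCont F (f z)" by (rule has_derivative_continuous)
      then have "(\<lambda>n. F (s n z)) \<longlonglongrightarrow> F (f z)"
        using slim[OF z] by (rule isCont_tendsto_compose)
      then show "(\<lambda>n. (l * z) *s vderiv (s (Suc n)) z) \<longlonglongrightarrow> F (f z)"
      proof (rule Lim_transform_eventually, intro always_eventually allI)
        fix n
        have "vholomorphic_on (s n) ?B" "s n 0 = 0" "\<And>z. z \<in> ?B \<Longrightarrow> s n z \<in> ball 0 \<rho>"
        proof -
          fix z assume z: "z \<in> ?B"
          have "norm (s n z - p z) \<le> 2 * K * (1 - (1/2) ^ n) * norm z ^ m" using step z by blast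
          also have "\<dots> \<le> 2 * K * 1 * norm z ^ m"
            using K by (intro mult_right_mono mult_left_mono) auto
          finally show "s n z \<in> ball 0 \<rho>" using small[of "s n" z] z by simp
        qed (use step in blast)+
        from T[OF this] z show "F (s n z) = (l * z) *s vderiv (s (Suc n)) z"
          by (simp add: s_Suc)
      qed
      have "(\<lambda>n. vderiv (s (Suc n)) z) \<longlonglongrightarrow> vderiv f z"
        using g'(2)[OF z, THEN LIMSEQ_Suc] vf[OF z] by (intro vec_tendstoI) simp
      then show "(\<lambda>n. (l * z) *s vderiv (s (Suc n)) z) \<longlonglongrightarrow> (l * z) *s vderiv f z"
        by (intro vec_tendstoI) (auto intro!: tendsto_intros tendsto_vec_nth)
    qed
  qed
qed

subsection \<open>Uniqueness\<close>

text \<open>The difference \<open>D\<close> vanishes to every order: a leading coefficient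
  \<open>c\<close> at order \<open>k \<ge> 2\<close> would satisfy
  \<open>A *v c = (k l) *s c\<close>, which nonresonance permits only for
  \<open>c = 0\<close>.\<close>

lemma invariant_disk_unique:
  assumes d: "\<delta> > 0"
    and f: "vholomorphic_on f (ball 0 \<delta>)" "f 0 = 0" "\<And>z. z \<in> ball 0 \<delta> \<Longrightarrow> (l * z) *s vderiv f z = F (f z)"
    and g: "vholomorphic_on g (ball 0 \<delta>)" "g 0 = 0" "\<And>z. z \<in> ball 0 \<delta> \<Longrightarrow> (l * z) *s vderiv g z = F (g z)"
    and eq: "vderiv f 0 = vderiv g 0" and z: "z \<in> ball 0 \<delta>"
  shows "f z = g z"
proof -
  define D where "D z = g z - f z" for z
  have D: "vholomorphic_on D (ball 0 \<delta>)"
    using f(1) g(1) by (auto simp: vholomorphic_on_def D_def intro!: holomorphic_on_diff)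
  have dD: "vderiv D z = vderiv g z - vderiv f z" if "z \<in> ball 0 \<delta>" for z
  proof -
    have "(D has_derivative (\<lambda>h. h *s vderiv g z - h *s vderiv f z)) (at z)"
      unfolding D_def using f g that by (intro has_derivative_diff vholomorphic_has_derivative) auto
    then have "(D has_derivative (\<lambda>h. h *s (vderiv g z - vderiv f z))) (at z)"
      by (simp add: vector_ssub_ldistrib)
    then show ?thesis by (rule has_derivative_imp_vderiv(2))
  qed
  have 0: "0 \<in> ball 0 \<delta>" using d by simp
  have cont: "(p \<longlongrightarrow> p 0) (at 0)" if "vholomorphic_on p (ball 0 \<delta>)" for p :: "complex \<Rightarrow> complex ^ 'n"
    using vholomorphic_imp_continuous_on[OF that] 0
    by (metis continuous_on_eq_continuous_at isCont_def open_ball)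
  have lim: "((\<lambda>z. inverse (z ^ Suc m) *s D z) \<longlongrightarrow> 0) (at 0)" for m
  proof (induction m)
    case 0
    show ?case
    proof (rule vec_tendstoI)
      fix i
      have "((\<lambda>z. D z $ i) has_field_derivative vderiv D 0 $ i) (at 0)"
        by (rule vholomorphic_has_field_derivative[OF D open_ball]) (use d in simp)
      moreover have "D 0 = 0" "vderiv D 0 = 0"
        using dD[of 0] d eq f(2) g(2) by (simp_all add: D_def)
      ultimately show "((\<lambda>z. (inverse (z ^ Suc 0) *s D z) $ i) \<longlongrightarrow> 0 $ i) (at 0)"
        by (simp add: has_field_derivative_iff divide_inverse mult.commute)
    qed
  next
    case (Suc m)
    let ?k = "Suc (Suc m)"
    obtain c where c: "((\<lambda>z. inverse (z ^ ?k) *s D z) \<longlongrightarrow> c) (at 0)"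
      using vholomorphic_order_step[OF D d Suc] by blast
    have 1: "((\<lambda>z. inverse (z ^ ?k) *s (F (g z) - F (f z))) \<longlongrightarrow> A *v c) (at 0)"
      by (rule tendsto_scaled_difference)
         (use cont[OF f(1)] cont[OF g(1)] f(2) g(2) c in \<open>simp_all only: D_def\<close>)
    \<comment> \<open>The second evaluation of the limit: the equations replace the difference of
      \<open>F\<close> by \<open>l\<close> times the Euler operator applied to
      \<open>D\<close>.\<close>
    have "((\<lambda>z. inverse (z ^ ?k) *s (F (g z) - F (f z))) \<longlongrightarrow> (of_nat ?k * l) *s c) (at 0)"
    proof (rule vec_tendstoI)
      fix i
      have "(\<lambda>z. D z $ i) holomorphic_on ball 0 \<delta>" using D by (simp add: vholomorphic_on_def)
      moreover have "((\<lambda>z. D z $ i / z ^ ?k) \<longlongrightarrow> c $ i) (at 0)"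
        using tendsto_vec_nth[OF c, of i] by (simp add: divide_inverse mult.commute)
      ultimately have "((\<lambda>z. z * deriv (\<lambda>z. D z $ i) z / z ^ ?k) \<longlongrightarrow> of_nat ?k * c $ i) (at 0)"
        using d by (intro holomorphic_order_deriv) auto
      then have "((\<lambda>z. l * (z * deriv (\<lambda>z. D z $ i) z / z ^ ?k)) \<longlongrightarrow> l * (of_nat ?k * c $ i)) (at 0)"
        by (rule tendsto_mult_left)
      moreover have "\<forall>\<^sub>F z in at 0. l * (z * deriv (\<lambda>z. D z $ i) z / z ^ ?k)
          = (inverse (z ^ ?k) *s (F (g z) - F (f z))) $ i"
        unfolding eventually_at
      proof (intro exI[of _ \<delta>] conjI ballI impI d)
        fix z :: complex assume "z \<noteq> 0 \<and> dist z 0 < \<delta>"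
        then have z: "z \<in> ball 0 \<delta>" by simp
        have "F (g z) - F (f z) = (l * z) *s vderiv D z"
          unfolding f(3)[OF z, symmetric] g(3)[OF z, symmetric] dD[OF z] by (simp only: vector_ssub_ldistrib)
        then show "l * (z * deriv (\<lambda>z. D z $ i) z / z ^ ?k)
          = (inverse (z ^ ?k) *s (F (g z) - F (f z))) $ i"
          by (simp add: vderiv_nth divide_inverse mult_ac)
      qed
      ultimately have "((\<lambda>z. (inverse (z ^ ?k) *s (F (g z) - F (f z))) $ i) \<longlongrightarrow> l * (of_nat ?k * c $ i)) (at 0)"
        by (rule Lim_transform_eventually)
      then show "((\<lambda>z. (inverse (z ^ ?k) *s (F (g z) - F (f z))) $ i) \<longlongrightarrow> ((of_nat ?k * l) *s c) $ i) (at 0)"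
        by (simp only: vector_smult_component mult_ac)
    qed
    from LIM_unique[OF 1 this] have "A *v c = (of_nat ?k * l) *s c" .
    then have "c = 0" using eigenvalue_charpoly_root nonres[of ?k] by auto
    then show ?case using c by simp
  qed
  have "D z $ i = 0" for i
  proof (rule holomorphic_infinite_order[OF _ d _ z])
    show "(\<lambda>z. D z $ i) holomorphic_on ball 0 \<delta>" using D by (simp add: vholomorphic_on_def)
    show "((\<lambda>z. D z $ i / z ^ m) \<longlongrightarrow> 0) (at 0)" for m
    proof (cases m)
      case 0
      then show ?thesis using tendsto_vec_nth[OF cont[OF D], of i] f(2) g(2) by (simp add: D_def)
    next
      case (Suc k)
      then show ?thesis using tendsto_vec_nth[OF lim[of k], of i]
        by (simp add: divide_inverse mult.commute)
    qed
  qed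
  then show ?thesis by (simp add: D_def vec_eq_iff)
qed

section \<open>From periodic orbits to a linearized parametrization\<close>

text \<open>For times near \<open>0\<close> the solution stays in \<open>U\<close>, hence on the
  graph, so \<open>x t = \<Psi> (x t $ i)\<close>. Differentiating this identity at time
  \<open>0\<close> gives the claim.\<close>

lemma tangent_to_graph:
  fixes \<Psi> :: "complex \<Rightarrow> complex ^ 'n" and x :: "real \<Rightarrow> complex ^ 'n"
  assumes \<Psi>: "vholomorphic_on \<Psi> (ball 0 \<delta>)" "\<And>w. w \<in> ball 0 \<delta> \<Longrightarrow> \<Psi> w $ i = w"
    and U: "open U" "D \<inter> U = \<Psi> ` ball 0 \<delta>" and w: "w \<in> ball 0 \<delta>"
    and x: "\<And>t :: real. x t \<in> D" "\<And>t. (x has_vector_derivative F (x t)) (at t)" "x 0 = \<Psi> w"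
  shows "F (\<Psi> w) = (F (\<Psi> w) $ i) *s vderiv \<Psi> w"
proof -
  have "continuous_on UNIV x"
    by (intro continuous_at_imp_continuous_on ballI has_vector_derivative_continuous[OF x(2)])
  then have S: "open (x -` U)" using U(1) by (rule open_vimage[rotated])
  have S0: "0 \<in> x -` U" using U(2) w x(3) by auto
  have xS: "\<Psi> (x t $ i) = x t" if "t \<in> x -` U" for t
  proof -
    have "x t \<in> \<Psi> ` ball 0 \<delta>" using that x(1) U(2) by blast
    then obtain u where "u \<in> ball 0 \<delta>" "x t = \<Psi> u" by blast
    then show ?thesis using \<Psi>(2) by simp
  qed
  have xi: "x 0 $ i = w" using \<Psi>(2)[OF w] x(3) by simp
  have d1: "(x has_vector_derivative F (\<Psi> w)) (at 0)" using x(2)[of 0] x(3) by simp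
  have "((\<lambda>t. x t $ i) has_vector_derivative F (\<Psi> w) $ i) (at 0)"
    by (rule bounded_linear.has_vector_derivative[OF bounded_linear_vec_nth d1])
  then have "((\<lambda>t. \<Psi> (x t $ i)) has_vector_derivative (F (\<Psi> w) $ i) *s vderiv \<Psi> (x 0 $ i)) (at 0)"
    by (intro vholomorphic_curve[where z = "\<lambda>t. x t $ i", OF \<Psi>(1) open_ball]) (simp_all only: xi w)
  then have "(x has_vector_derivative (F (\<Psi> w) $ i) *s vderiv \<Psi> w) (at 0)"
    unfolding xi by (rule has_vector_derivative_transform_within_open[OF _ S S0 xS])
  with d1 show ?thesis by (rule vector_derivative_unique_at)
qed

text \<open>The disk is a graph \<open>\<Psi>\<close> carrying a one-dimensional field
  \<open>g\<close>; \<open>\<theta>\<close> is \<open>\<Psi>\<close> in the linearizing parameter.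
  The assumption \<open>spec\<close> makes the zero of \<open>g\<close> simple. The clauses on
  \<open>h\<close> recover the parameter from coordinate \<open>i\<close>, so that the flow can be
  read off as \<open>u' = \<mu> u\<close>.\<close>

lemma linearized_disk:
  assumes emb: "holomorphic_disk_embedding \<psi> (ball a r)" and D: "D = \<psi> ` ball a r"
    and D0: "0 \<in> D" and DR: "D \<subseteq> ball 0 R"
    and inv: "\<And>y. y \<in> D \<Longrightarrow> y \<noteq> 0 \<Longrightarrow>
      \<exists>x :: real \<Rightarrow> complex ^ 'n. (\<forall>t. x t \<in> D \<and> (x has_vector_derivative F (x t)) (at t)) \<and> x 0 = y"
    and spec: "\<And>u :: complex ^ 'n. A *v u = 0 \<Longrightarrow> u = 0"
  obtains i \<mu> \<eta> U h V and \<theta> :: "complex \<Rightarrow> complex ^ 'n"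
  where "\<eta> > 0" "vholomorphic_on \<theta> (ball 0 \<eta>)" "\<theta> 0 = 0" "vderiv \<theta> 0 \<noteq> 0"
    "A *v vderiv \<theta> 0 = \<mu> *s vderiv \<theta> 0"
    "\<And>u. u \<in> ball 0 \<eta> \<Longrightarrow> (\<mu> * u) *s vderiv \<theta> u = F (\<theta> u)"
    "open U" "0 \<in> U" "D \<inter> U = \<theta> ` ball 0 \<eta>"
    "open V" "h holomorphic_on V"
    "\<And>u. u \<in> ball 0 \<eta> \<Longrightarrow> \<theta> u $ i \<in> V" "\<And>u. u \<in> ball 0 \<eta> \<Longrightarrow> h (\<theta> u $ i) = u"
    "\<And>u. u \<in> ball 0 \<eta> \<Longrightarrow> deriv h (\<theta> u $ i) * (F (\<theta> u) $ i) = \<mu> * u"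
proof -
  obtain b where b: "b \<in> ball a r" "\<psi> b = 0" using D D0 by auto
  obtain i \<delta> U and \<Psi> :: "complex \<Rightarrow> complex ^ 'n" where \<Psi>: "\<delta> > 0" "vholomorphic_on \<Psi> (ball 0 \<delta>)" "\<Psi> 0 = 0"
    and \<Psi>i: "\<And>w. w \<in> ball 0 \<delta> \<Longrightarrow> \<Psi> w $ i = w" and U: "open U" "0 \<in> U" "D \<inter> U = \<Psi> ` ball 0 \<delta>"
    using disk_as_graph[OF emb b] unfolding D by metis
  let ?B = "ball (0 :: complex) \<delta>"
  have B0: "0 \<in> ?B" using \<Psi>(1) by simp
  have \<Psi>D: "\<Psi> ` ?B \<subseteq> D" using U(3) by blast
  then have \<Psi>R: "\<Psi> ` ?B \<subseteq> ball 0 R" using DR by blast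
  have tang: "F (\<Psi> w) = (F (\<Psi> w) $ i) *s vderiv \<Psi> w" if w: "w \<in> ?B" for w
  proof (cases "w = 0")
    case True
    then show ?thesis by (simp only: \<Psi>(3) F_0) simp
  next
    case False
    have "\<Psi> w \<noteq> 0" using \<Psi>i[OF w] False by auto
    moreover have "\<Psi> w \<in> D" using \<Psi>D w by blast
    ultimately obtain x :: "real \<Rightarrow> complex ^ 'n"
      where x: "\<And>t. x t \<in> D" "\<And>t. (x has_vector_derivative F (x t)) (at t)" "x 0 = \<Psi> w"
      using inv by metis
    show ?thesis by (rule tangent_to_graph[where x = x, OF \<Psi>(2) \<Psi>i U(1,3) w x])
  qed
  \<comment> \<open>By \<open>tang\<close> and \<open>\<Psi> w $ i = w\<close>, this is the field
    induced on the graph in the coordinate \<open>w\<close>.\<close>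
  define g where "g w = F (\<Psi> w) $ i" for w
  have FPsi: "vholomorphic_on (\<lambda>w. F (\<Psi> w)) ?B"
    by (rule vholomorphic_compose_map[OF hol open_ball \<Psi>(2) open_ball \<Psi>R])
  then have g: "g holomorphic_on ?B" by (simp add: vholomorphic_on_def g_def[abs_def])
  define p where "p = vderiv \<Psi> 0"
  have dF: "((\<lambda>w. F (\<Psi> w)) has_derivative (\<lambda>h. h *s (A *v p))) (at 0)"
    unfolding p_def by (rule has_derivative_compose_vholomorphic[OF \<Psi>(2) open_ball B0]) (simp add: \<Psi>(3) deriv_0)
  note dFi = has_derivative_imp_vderiv(1)[OF dF]
  define \<mu> where "\<mu> = (A *v p) $ i"
  have dg: "(g has_field_derivative \<mu>) (at 0)" unfolding g_def[abs_def] \<mu>_def by (rule dFi)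
  have g0: "g 0 = 0" by (simp add: g_def \<Psi>(3) F_0)
  \<comment> \<open>Differentiate \<open>tang\<close> at \<open>0\<close>: as
    \<open>g 0 = 0\<close>, the product rule leaves only \<open>\<mu>\<close> times the tangent
    vector \<open>p\<close>.\<close>
  have eigp: "A *v p = \<mu> *s p"
  proof (rule vec_eq_iff[THEN iffD2], rule allI)
    fix j
    define k where "k w = vderiv \<Psi> w $ j" for w
    have "k holomorphic_on ?B"
      unfolding k_def[abs_def] vderiv_nth using \<Psi>(2)
      by (intro holomorphic_deriv open_ball) (auto simp: vholomorphic_on_def)
    then have "(k has_field_derivative deriv k 0) (at 0)" using B0 open_ball by (metis holomorphic_derivI)
    from DERIV_mult[OF dg this] have "((\<lambda>w. g w * k w) has_field_derivative \<mu> * k 0) (at 0)"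
      by (simp add: g0)
    moreover have "g w * k w = F (\<Psi> w) $ j" if "w \<in> ?B" for w
      using arg_cong[OF tang[OF that], of "\<lambda>v. v $ j"] by (simp add: g_def k_def)
    ultimately have "((\<lambda>w. F (\<Psi> w) $ j) has_field_derivative \<mu> * k 0) (at 0)"
      by (rule has_field_derivative_transform_within_open[OF _ open_ball B0])
    from DERIV_unique[OF dFi this] show "(A *v p) $ j = (\<mu> *s p) $ j" by (simp add: k_def p_def)
  qed
  have pi: "p $ i = 1"
  proof -
    have "((\<lambda>w. \<Psi> w $ i) has_field_derivative p $ i) (at 0)"
      unfolding p_def by (rule vholomorphic_has_field_derivative[OF \<Psi>(2) open_ball B0])
    moreover have "((\<lambda>w. \<Psi> w $ i) has_field_derivative 1) (at 0)"
      by (rule has_field_derivative_transform_within_open[OF DERIV_ident open_ball B0]) (simp add: \<Psi>i)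
    ultimately show ?thesis by (rule DERIV_unique)
  qed
  have "p \<noteq> 0" using pi by auto
  have \<mu>: "\<mu> \<noteq> 0"
  proof
    assume "\<mu> = 0"
    then have "A *v p = 0" using eigp by simp
    then show False using spec \<open>p \<noteq> 0\<close> by blast
  qed
  obtain h e where h: "e > 0" "e \<le> \<delta>" "h holomorphic_on ball 0 e" "h 0 = 0" "inj_on h (ball 0 e)"
    and hg: "\<And>w. w \<in> ball 0 e \<Longrightarrow> deriv h w * g w = \<mu> * h w"
    using linearize_at_simple_zero[OF g \<Psi>(1) g0 DERIV_imp_deriv[OF dg] \<mu>] by metis
  obtain \<kappa> where \<kappa>: "\<kappa> holomorphic_on (h ` ball 0 e)" "\<And>w. w \<in> ball 0 e \<Longrightarrow> deriv h w * deriv \<kappa> (h w) = 1"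
      "\<And>w. w \<in> ball 0 e \<Longrightarrow> \<kappa> (h w) = w"
    using holomorphic_has_inverse[OF h(3) open_ball h(5)] by metis
  have op: "open (h ` ball 0 e)" by (rule open_mapping_thm3[OF h(3) open_ball h(5)])
  have "0 \<in> h ` ball 0 e" using h(1,4) by (metis centre_in_ball imageI)
  then obtain \<eta> where \<eta>: "\<eta> > 0" "ball 0 \<eta> \<subseteq> h ` ball 0 e" using op open_contains_ball by blast
  have kap: "\<kappa> u \<in> ball 0 e" "h (\<kappa> u) = u" if u: "u \<in> ball 0 \<eta>" for u
  proof -
    obtain w where "w \<in> ball 0 e" "u = h w" using \<eta>(2) u by blast
    then show "\<kappa> u \<in> ball 0 e" "h (\<kappa> u) = u" using \<kappa>(3) by auto
  qed
  have eB: "ball 0 e \<subseteq> ?B" using h(2) by (rule subset_ball)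
  have kB: "\<kappa> u \<in> ?B" if "u \<in> ball 0 \<eta>" for u using kap(1)[OF that] eB by blast
  have khol: "\<kappa> holomorphic_on ball 0 \<eta>" using \<kappa>(1) \<eta>(2) by (rule holomorphic_on_subset)
  have kap0: "\<kappa> 0 = 0" using \<kappa>(3)[of 0] h(1,4) by simp
  define \<theta> where "\<theta> u = \<Psi> (\<kappa> u)" for u
  have "\<kappa> ` ball 0 \<eta> \<subseteq> ?B" using kB by blast
  note comp = vholomorphic_compose_scalar[OF \<Psi>(2) open_ball khol open_ball this, folded \<theta>_def[abs_def]]
  have dk: "deriv h (\<kappa> u) * deriv \<kappa> u = 1" if "u \<in> ball 0 \<eta>" for u
    using \<kappa>(2)[OF kap(1)[OF that]] kap(2)[OF that] by simp
  have \<theta>i: "\<theta> u $ i = \<kappa> u" if "u \<in> ball 0 \<eta>" for u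
    using \<Psi>i[OF kB[OF that]] by (simp add: \<theta>_def)
  have hF: "deriv h (\<kappa> u) * g (\<kappa> u) = \<mu> * u" if "u \<in> ball 0 \<eta>" for u
    using hg[OF kap(1)[OF that]] kap(2)[OF that] by simp
  have muk: "\<mu> * u * deriv \<kappa> u = g (\<kappa> u)" if "u \<in> ball 0 \<eta>" for u
  proof -
    have "\<mu> * u * deriv \<kappa> u = (deriv h (\<kappa> u) * deriv \<kappa> u) * g (\<kappa> u)"
      unfolding hF[OF that, symmetric] by (simp only: mult_ac)
    then show ?thesis by (simp add: dk[OF that])
  qed
  \<comment> \<open>\<open>W\<close> is the range of \<open>\<kappa>\<close>. Requiring coordinate
    \<open>i\<close> to lie in \<open>W\<close> shrinks \<open>U\<close> so that it meets
    \<open>D\<close> exactly in the image of \<open>\<theta>\<close>.\<close>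
  define W where "W = ball 0 e \<inter> h -` ball 0 \<eta>"
  have W: "open W" unfolding W_def
    by (rule continuous_open_preimage[OF holomorphic_on_imp_continuous_on[OF h(3)] open_ball open_ball])
  have kW: "\<kappa> ` ball 0 \<eta> = W"
  proof
    show "\<kappa> ` ball 0 \<eta> \<subseteq> W" using kap by (auto simp: W_def)
    show "W \<subseteq> \<kappa> ` ball 0 \<eta>"
    proof
      fix w assume "w \<in> W"
      then have "\<kappa> (h w) = w" "h w \<in> ball 0 \<eta>" using \<kappa>(3) by (auto simp: W_def)
      then show "w \<in> \<kappa> ` ball 0 \<eta>" by (metis imageI)
    qed
  qed
  have WB: "W \<subseteq> ?B" using eB by (auto simp: W_def)
  have img: "D \<inter> (U \<inter> (\<lambda>x. x $ i) -` W) = \<theta> ` ball 0 \<eta>"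
  proof -
    have "D \<inter> (U \<inter> (\<lambda>x. x $ i) -` W) = \<Psi> ` ?B \<inter> (\<lambda>x. x $ i) -` W" using U(3) by blast
    also have "\<dots> = \<Psi> ` W" using \<Psi>i WB by auto
    also have "\<dots> = \<theta> ` ball 0 \<eta>" unfolding \<theta>_def kW[symmetric] by (simp add: image_image)
    finally show ?thesis .
  qed
  have u0: "0 \<in> ball (0::complex) \<eta>" using \<eta>(1) by simp
  have \<theta>0: "\<theta> 0 = 0" by (simp add: \<theta>_def kap0 \<Psi>(3))
  have v\<theta>: "vderiv \<theta> 0 = deriv \<kappa> 0 *s p" using comp(2)[OF u0] by (simp add: p_def kap0)
  have kn: "deriv \<kappa> 0 \<noteq> 0" using dk[OF u0] by auto
  show ?thesis
  proof (rule that[of \<eta> \<theta> \<mu> "U \<inter> (\<lambda>x. x $ i) -` W" "ball 0 e" h i])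
    show "vderiv \<theta> 0 \<noteq> 0" unfolding v\<theta> using kn pi by (metis mult.right_neutral vector_smult_component zero_index)
    show "A *v vderiv \<theta> 0 = \<mu> *s vderiv \<theta> 0"
      unfolding v\<theta> vector_scalar_commute eigp by (simp add: vec_eq_iff)
    show "open (U \<inter> (\<lambda>x. x $ i) -` W)" using U(1) open_vimage_vec_nth[OF W] by (rule open_Int)
    have "0 \<in> \<theta> ` ball 0 \<eta>" using \<theta>0 u0 by (metis imageI)
    then show "0 \<in> U \<inter> (\<lambda>x. x $ i) -` W" using img by blast
    fix u assume u: "u \<in> ball (0::complex) \<eta>"
    show "(\<mu> * u) *s vderiv \<theta> u = F (\<theta> u)"
      unfolding comp(2)[OF u] using tang[OF kB[OF u]] muk[OF u] by (simp add: \<theta>_def g_def)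
    show "\<theta> u $ i \<in> ball 0 e" "h (\<theta> u $ i) = u" using kap[OF u] by (simp_all only: \<theta>i[OF u])
    show "deriv h (\<theta> u $ i) * (F (\<theta> u) $ i) = \<mu> * u"
      using hF[OF u] unfolding \<theta>i[OF u] by (simp add: g_def \<theta>_def)
  qed (use \<eta>(1) comp(1) \<theta>0 img h(3) in auto)
qed

text \<open>In the coordinate \<open>u = h (x $ i)\<close> the flow is linear; solutions agree with
  \<open>u\<^sub>0 exp (\<mu> t)\<close> on a relatively clopen set of times.\<close>

lemma orbit_in_linearized_disk:
  fixes \<theta> :: "complex \<Rightarrow> complex ^ 'n" and x :: "real \<Rightarrow> complex ^ 'n"
  assumes \<theta>: "vholomorphic_on \<theta> (ball 0 \<eta>)" and U: "open U" "D \<inter> U = \<theta> ` ball 0 \<eta>"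
    and h: "open V" "h holomorphic_on V"
    and hV: "\<And>u. u \<in> ball 0 \<eta> \<Longrightarrow> \<theta> u $ i \<in> V" and hu: "\<And>u. u \<in> ball 0 \<eta> \<Longrightarrow> h (\<theta> u $ i) = u"
    and hF: "\<And>u. u \<in> ball 0 \<eta> \<Longrightarrow> deriv h (\<theta> u $ i) * (F (\<theta> u) $ i) = \<mu> * u"
    and x: "\<And>t. x t \<in> D" "\<And>t. (x has_vector_derivative F (x t)) (at t)" "x 0 = \<theta> z"
    and small: "\<And>t. 0 \<le> t \<Longrightarrow> t \<le> T \<Longrightarrow> z * exp (\<mu> * of_real t) \<in> ball 0 \<eta>"
    and t: "0 \<le> t" "t \<le> T"
  shows "x t = \<theta> (z * exp (\<mu> * of_real t))"
proof -
  define y where "y t = \<theta> (z * exp (\<mu> * of_real t))" for t :: real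
  define E where "E = {t \<in> {0..T}. x t - y t = 0}"
  have contx: "continuous_on S x" for S
    by (intro continuous_at_imp_continuous_on ballI has_vector_derivative_continuous[OF x(2)])
  have conty: "continuous_on {0..T} y"
    unfolding y_def
    by (rule continuous_on_compose2[OF vholomorphic_imp_continuous_on[OF \<theta>]])
       (use small in \<open>auto intro!: continuous_intros\<close>)
  have closed: "closedin (top_of_set {0..T}) E"
    unfolding E_def by (rule continuous_closedin_preimage_constant[OF continuous_on_diff[OF contx conty]])
  have "openin (top_of_set {0..T}) E"
    unfolding openin_contains_ball
  proof (intro conjI ballI)
    show "E \<subseteq> {0..T}" by (auto simp: E_def)
    fix t1 assume "t1 \<in> E"
    then have t1: "0 \<le> t1" "t1 \<le> T" "x t1 = y t1" by (auto simp: E_def)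
    have "y t1 \<in> U" using small[OF t1(1,2)] U(2) by (auto simp: y_def)
    moreover have "open (x -` U)" using U(1) contx by (rule open_vimage)
    ultimately obtain e where e: "e > 0" "ball t1 e \<subseteq> x -` U"
      using t1(3) open_contains_ball by (metis vimageI)
    define u where "u s = h (x s $ i)" for s
    have xu: "u s \<in> ball 0 \<eta>" "x s = \<theta> (u s)" if s: "s \<in> ball t1 e" for s
    proof -
      have "x s \<in> \<theta> ` ball 0 \<eta>" using e(2) s x(1) U(2) by blast
      then obtain w where w: "w \<in> ball 0 \<eta>" "x s = \<theta> w" by blast
      then have "u s = w" using hu by (simp add: u_def)
      then show "u s \<in> ball 0 \<eta>" "x s = \<theta> (u s)" using w by auto
    qed
    have du: "(u has_vector_derivative \<mu> * u s) (at s)" if s: "s \<in> ball t1 e" for s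
    proof -
      have "x s $ i \<in> V" using hV[OF xu(1)[OF s]] xu(2)[OF s] by simp
      then have "(h has_field_derivative deriv h (x s $ i)) (at (x s $ i))"
        using h by (intro holomorphic_derivI)
      moreover have "((\<lambda>s. x s $ i) has_vector_derivative F (x s) $ i) (at s)"
        by (rule bounded_linear.has_vector_derivative[OF bounded_linear_vec_nth x(2)])
      ultimately have "((h \<circ> (\<lambda>s. x s $ i)) has_vector_derivative F (x s) $ i * deriv h (x s $ i)) (at s)"
        by (rule field_vector_diff_chain_at[rotated])
      moreover have "F (x s) $ i * deriv h (x s $ i) = \<mu> * u s"
        using hF[OF xu(1)[OF s]] unfolding xu(2)[OF s, symmetric] by (simp only: mult.commute)
      ultimately show ?thesis by (simp add: u_def[abs_def] comp_def)
    qed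
    \<comment> \<open>An integrating factor: \<open>u' = \<mu> u\<close> makes \<open>c\<close>
      constant on the interval, and its value at \<open>t1\<close> is \<open>z\<close>.\<close>
    define c where "c s = u s * exp (- \<mu> * of_real s)" for s :: real
    have dc: "(c has_vector_derivative 0) (at s within ball t1 e)" if "s \<in> ball t1 e" for s
    proof -
      have "((\<lambda>s. exp (- \<mu> * of_real s)) has_vector_derivative (- \<mu>) * exp (- \<mu> * of_real s)) (at s)"
      proof -
        have "((\<lambda>z. exp (- \<mu> * z)) has_field_derivative (- \<mu>) * exp (- \<mu> * of_real s)) (at (of_real s))"
          by (auto intro!: derivative_eq_intros)
        from has_vector_derivative_real_field[OF this] show ?thesis by simp
      qed
      from has_vector_derivative_mult[OF du[OF that] this]
      have "(c has_vector_derivative 0) (at s)" by (simp add: c_def[abs_def] algebra_simps)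
      then show ?thesis by (rule has_vector_derivative_at_within)
    qed
    obtain k where k: "\<And>s. s \<in> ball t1 e \<Longrightarrow> c s = k"
      using has_vector_derivative_zero_constant[OF convex_ball dc] by blast
    have "u t1 = z * exp (\<mu> * of_real t1)"
      using hu[OF small[OF t1(1,2)]] t1(3) by (simp add: u_def y_def)
    then have ct1: "c t1 = z" by (simp add: c_def mult.assoc flip: exp_add)
    have "x s = y s" if "s \<in> ball t1 e" for s
    proof -
      have "c s = z" using k[OF that] k[of t1] ct1 e(1) by simp
      then have "u s = z * exp (\<mu> * of_real s)"
        by (simp add: c_def mult.assoc flip: exp_add) (simp add: c_def exp_minus field_simps)
      then show ?thesis using xu(2)[OF that] by (simp add: y_def)
    qed
    then show "\<exists>e>0. ball t1 e \<inter> {0..T} \<subseteq> E" using e(1) by (auto simp: E_def)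
  qed
  with closed have "E = {} \<or> E = {0..T}"
    using connected_Icc[of 0 T, unfolded connected_clopen] by blast
  moreover have "0 \<in> E" using x(3) t by (simp add: E_def y_def)
  ultimately have "t \<in> E" using t by auto
  then show ?thesis by (simp add: E_def y_def)
qed

text \<open>An orbit started close enough to \<open>0\<close> remains in the linearized part up to
  time \<open>T\<close>. Its parameter is then \<open>u0 * exp (\<mu> * T)\<close>, and returning to
  the start forces this to be \<open>u0\<close>.\<close>

lemma linearized_disk_exponent:
  fixes \<theta> :: "complex \<Rightarrow> complex ^ 'n"
  assumes \<eta>: "\<eta> > 0" and \<theta>: "vholomorphic_on \<theta> (ball 0 \<eta>)" "\<theta> 0 = 0" and U: "open U" "D \<inter> U = \<theta> ` ball 0 \<eta>"
    and h: "open V" "h holomorphic_on V"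
    and hV: "\<And>u. u \<in> ball 0 \<eta> \<Longrightarrow> \<theta> u $ i \<in> V" and hu: "\<And>u. u \<in> ball 0 \<eta> \<Longrightarrow> h (\<theta> u $ i) = u"
    and hF: "\<And>u. u \<in> ball 0 \<eta> \<Longrightarrow> deriv h (\<theta> u $ i) * (F (\<theta> u) $ i) = \<mu> * u"
    and T: "T > 0"
    and per: "\<And>y. y \<in> D \<Longrightarrow> y \<noteq> 0 \<Longrightarrow> \<exists>x :: real \<Rightarrow> complex ^ 'n.
      (\<forall>t. x t \<in> D \<and> (x has_vector_derivative F (x t)) (at t)) \<and> x 0 = y \<and> x T = y"
  shows "exp (\<mu> * of_real T) = 1"
proof -
  \<comment> \<open>The exponential factor offsets the largest growth that
    \<open>exp (\<mu> * t)\<close> can have on the time interval, whatever the sign of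
    \<open>Re \<mu>\<close>; the parameter never exceeds \<open>\<eta> / 2\<close> in norm.\<close>
  define u0 :: complex where "u0 = of_real (\<eta> / 2 * exp (- norm \<mu> * T))"
  have u0: "u0 \<noteq> 0" using \<eta> by (simp add: u0_def)
  have small: "u0 * exp (\<mu> * of_real t) \<in> ball 0 \<eta>" if "0 \<le> t" "t \<le> T" for t
  proof -
    have "norm (exp (\<mu> * of_real t)) \<le> exp (norm (\<mu> * of_real t))" by (rule norm_exp)
    also have "\<dots> \<le> exp (norm \<mu> * T)" using that by (simp add: norm_mult mult_left_mono)
    finally have "norm u0 * norm (exp (\<mu> * of_real t)) \<le> norm u0 * exp (norm \<mu> * T)"
      by (rule mult_left_mono) simp
    also have "\<dots> = \<eta> / 2"
    proof -
      have "norm u0 = \<eta> / 2 * exp (- norm \<mu> * T)"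
        unfolding u0_def norm_of_real using \<eta> by simp
      then show ?thesis by (simp add: exp_minus field_simps)
    qed
    finally have "norm (u0 * exp (\<mu> * of_real t)) \<le> \<eta> / 2" by (simp only: norm_mult)
    then show ?thesis using \<eta> unfolding mem_ball dist_0_norm by linarith
  qed
  have ub: "u0 \<in> ball 0 \<eta>" using small[of 0] T by simp
  have "\<theta> u0 \<noteq> 0"
  proof
    assume "\<theta> u0 = 0"
    then have "u0 = h (\<theta> 0 $ i)" using hu[OF ub] \<theta>(2) by simp
    also have "\<dots> = 0" using hu[of 0] \<eta> by simp
    finally show False using u0 by simp
  qed
  moreover have "\<theta> u0 \<in> D" using U(2) ub by blast
  ultimately obtain x :: "real \<Rightarrow> complex ^ 'n"
    where x: "\<forall>t. x t \<in> D \<and> (x has_vector_derivative F (x t)) (at t)" "x 0 = \<theta> u0" "x T = \<theta> u0"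
    using per by blast
  have "x T = \<theta> (u0 * exp (\<mu> * of_real T))"
    by (rule orbit_in_linearized_disk[where x = x and z = u0 and t = T and T = T,
          OF \<theta>(1) U h hV hu hF _ _ x(2) small]) (use x(1) T in auto)
  then have "u0 * exp (\<mu> * of_real T) = u0"
    using hu[OF small[of T]] hu[OF ub] x(3) T by simp
  then show ?thesis using u0 by simp
qed

section \<open>The embedded disk of periodic orbits and its comparison with other disks\<close>

text \<open>A coordinate in which \<open>v\<close> does not vanish is injective on a smaller disk.
  Its holomorphic inverse, applied to that coordinate, is a continuous inverse of
  \<open>f\<close>.\<close>

lemma embedded_invariant_disk:
  obtains f r where "r > 0" "holomorphic_disk_embedding f (ball 0 r)" "f ` ball 0 r \<subseteq> ball 0 R" "f 0 = 0"
    "vderiv f 0 = v" "\<And>z. z \<in> ball 0 r \<Longrightarrow> (l * z) *s vderiv f z = F (f z)"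
proof -
  obtain f \<delta> where \<delta>: "\<delta> > 0" and f: "vholomorphic_on f (ball 0 \<delta>)" "f ` ball 0 \<delta> \<subseteq> ball 0 R" "f 0 = 0"
    "vderiv f 0 = v" "\<And>z. z \<in> ball 0 \<delta> \<Longrightarrow> (l * z) *s vderiv f z = F (f z)"
    by (rule invariant_disk) blast
  obtain j where j: "v $ j \<noteq> 0" using v_nonzero by (auto simp: vec_eq_iff)
  define k where "k = (\<lambda>z. f z $ j)"
  have k: "k holomorphic_on ball 0 \<delta>" using f(1) by (simp add: vholomorphic_on_def k_def)
  have k': "deriv k 0 \<noteq> 0" using j f(4) unfolding k_def by (metis vderiv_nth)
  have z0: "(0 :: complex) \<in> ball 0 \<delta>" using \<delta> by simp
  obtain r where r: "r > 0" "ball (0 :: complex) r \<subseteq> ball 0 \<delta>" "inj_on k (ball 0 r)"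
    by (rule has_complex_derivative_locally_injective[OF k z0 open_ball k'])
  have kr: "k holomorphic_on ball 0 r" using k r(2) by (rule holomorphic_on_subset)
  obtain \<kappa> where \<kappa>: "\<kappa> holomorphic_on (k ` ball 0 r)" "\<And>z. z \<in> ball 0 r \<Longrightarrow> \<kappa> (k z) = z"
    using holomorphic_has_inverse[OF kr open_ball r(3)] by metis
  have fr: "vholomorphic_on f (ball 0 r)" using f(1) r(2) by (rule vholomorphic_on_subset)
  have "homeomorphism (ball 0 r) (f ` ball 0 r) f (\<lambda>x. \<kappa> (x $ j))"
  proof (rule homeomorphismI)
    show "continuous_on (ball 0 r) f" using fr by (rule vholomorphic_imp_continuous_on)
    show "continuous_on (f ` ball 0 r) (\<lambda>x. \<kappa> (x $ j))"
      by (rule continuous_on_compose2[OF holomorphic_on_imp_continuous_on[OF \<kappa>(1)]])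
         (auto intro!: continuous_intros simp: k_def)
  qed (use \<kappa>(2) in \<open>auto simp: k_def\<close>)
  moreover have "deriv (\<lambda>w. f w $ j) z \<noteq> 0" if "z \<in> ball 0 r" for z
    using holomorphic_injective_imp_regular[OF kr open_ball r(3) that] by (simp add: k_def)
  ultimately have "holomorphic_disk_embedding f (ball 0 r)"
    using fr unfolding holomorphic_disk_embedding_def vholomorphic_on_def by blast
  then show ?thesis using f r by (intro that[of r f]) auto
qed

text \<open>Since \<open>l\<close> is imaginary, multiplication by \<open>exp (l * t)\<close> is a
  rotation of the parameter disk; solutions therefore exist for all times and remain in the
  disk.\<close>

lemma disk_of_periodic_orbits:
  assumes l: "l = of_real \<omega> * \<i>"
    and emb: "holomorphic_disk_embedding f (ball 0 r)" and r: "r > 0"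
    and f: "f ` ball 0 r \<subseteq> ball 0 R" "f 0 = 0" "\<And>z. z \<in> ball 0 r \<Longrightarrow> (l * z) *s vderiv f z = F (f z)"
  shows "consists_of_0_and_periodic_orbits F (ball 0 R) (2 * pi / \<bar>\<omega>\<bar>) (f ` ball 0 r)"
proof -
  have w: "\<omega> \<noteq> 0" using l l_nonzero by auto
  have hf: "vholomorphic_on f (ball 0 r)" using emb by (simp add: holomorphic_disk_embedding_def vholomorphic_on_def)
  obtain \<sigma> where "homeomorphism (ball 0 r) (f ` ball 0 r) f \<sigma>"
    using emb by (auto simp: holomorphic_disk_embedding_def)
  then have inj: "inj_on f (ball 0 r)" by (metis homeomorphism_def inj_on_inverseI)
  define x where "x z t = f (z * exp (l * of_real t))" for z and t :: real
  have inb: "z * exp (l * of_real t) \<in> ball 0 r" if "z \<in> ball 0 r" for z t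
    using that by (simp add: l norm_mult)
  define \<C> where "\<C> = (\<lambda>z. range (x z)) ` (ball 0 r - {0})"
  have "periodic_orbit F (ball 0 R) (2 * pi / \<bar>\<omega>\<bar>) (range (x z))" if z: "z \<in> ball 0 r" "z \<noteq> 0" for z
    unfolding periodic_orbit_def
  proof (intro exI[of _ "x z"] conjI refl)
    show "least_period (x z) (2 * pi / \<bar>\<omega>\<bar>)"
      unfolding x_def l by (rule least_period_exp[OF inj z w])
    show "solution_in F (ball 0 R) (x z)"
      unfolding solution_in_def
    proof (intro allI conjI)
      fix t :: real
      show "x z t \<in> ball 0 R" using inb[OF z(1)] f(1) unfolding x_def by blast
      have "((\<lambda>s. z * exp (l * s)) has_field_derivative l * (z * exp (l * of_real t))) (at (of_real t))"
        by (auto intro!: derivative_eq_intros)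
      from has_vector_derivative_real_field[OF this]
      have "((\<lambda>t. z * exp (l * of_real t)) has_vector_derivative l * (z * exp (l * of_real t))) (at t)" .
      from vholomorphic_curve[where z = "\<lambda>t. z * exp (l * of_real t)", OF hf open_ball inb[OF z(1)] this]
      show "(x z has_vector_derivative F (x z t)) (at t)"
        unfolding f(3)[OF inb[OF z(1)]] x_def .
    qed
  qed
  moreover have "f ` ball 0 r - {0} = \<Union>\<C>"
  proof (intro equalityI subsetI)
    fix y assume "y \<in> f ` ball 0 r - {0}"
    then obtain z where z: "z \<in> ball 0 r" "y = f z" "z \<noteq> 0" using f(2) by blast
    then have "y = x z 0" by (simp add: x_def)
    then show "y \<in> \<Union>\<C>" using z unfolding \<C>_def by blast
  next
    fix y assume y: "y \<in> \<Union>\<C>"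
    then obtain z t where z: "z \<in> ball 0 r" "z \<noteq> 0" "y = f (z * exp (l * of_real t))"
      using y unfolding \<C>_def x_def by blast
    \<comment> \<open>The rotated parameter is nonzero and \<open>f\<close> is injective, so an
      orbit never reaches \<open>0\<close>.\<close>
    have "f (z * exp (l * of_real t)) \<noteq> f 0"
      using inj_onD[OF inj _ inb[OF z(1)], of t 0] z r by auto
    then show "y \<in> f ` ball 0 r - {0}" using z inb[OF z(1)] f(2) by auto
  qed
  moreover have "0 \<in> f ` ball 0 r" using f(2) r by (metis centre_in_ball imageI)
  moreover have "\<forall>C\<in>\<C>. periodic_orbit F (ball 0 R) (2 * pi / \<bar>\<omega>\<bar>) C"
    using calculation(1) unfolding \<C>_def by blast
  ultimately show ?thesis
    unfolding consists_of_0_and_periodic_orbits_def by blast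
qed

text \<open>The period makes the exponent \<open>\<mu>\<close> of the other disk an integer multiple
  of \<open>l\<close>, hence \<open>l\<close> itself by \<open>spec\<close>. Simplicity makes its
  tangent vector a multiple \<open>c *s v\<close>, and then \<open>\<theta> u\<close> and
  \<open>f (c * u)\<close> solve the same equation with the same derivative at
  \<open>0\<close>.\<close>

lemma periodic_disk_unique:
  assumes l: "l = of_real \<omega> * \<i>"
    and emb: "holomorphic_disk_embedding f (ball 0 r)" and r: "r > 0"
    and f: "f 0 = 0" "vderiv f 0 = v" "\<And>z. z \<in> ball 0 r \<Longrightarrow> (l * z) *s vderiv f z = F (f z)"
    and spec: "\<And>k. poly (charpoly A) (of_int k * l) = 0 \<Longrightarrow> k = 1"
    and simple: "charpoly A \<noteq> 0" "order l (charpoly A) = 1"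
    and D: "analytic_disk_in (ball 0 R) D"
      "consists_of_0_and_periodic_orbits F (ball 0 R) (2 * pi / \<bar>\<omega>\<bar>) D"
  shows "coincide_near_0 D (f ` ball 0 r)"
proof -
  let ?T = "2 * pi / \<bar>\<omega>\<bar>"
  have w: "\<omega> \<noteq> 0" using l l_nonzero by auto
  then have T: "?T > 0" by simp
  obtain \<psi> a s where \<psi>: "holomorphic_disk_embedding \<psi> (ball a s)" "D = \<psi> ` ball a s" and DR: "D \<subseteq> ball 0 R"
    using D(1) unfolding analytic_disk_in_def by blast
  have D0: "0 \<in> D" using D(2) by (simp add: consists_of_0_and_periodic_orbits_def)
  have per: "\<exists>x :: real \<Rightarrow> complex ^ 'n. (\<forall>t. x t \<in> D \<and> (x has_vector_derivative F (x t)) (at t)) \<and> x 0 = y \<and> x ?T = y"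
    if y: "y \<in> D" "y \<noteq> 0" for y
  proof -
    obtain C where C: "periodic_orbit F (ball 0 R) ?T C" "y \<in> C" "C \<subseteq> D"
      using D(2) y unfolding consists_of_0_and_periodic_orbits_def by blast
    obtain x :: "real \<Rightarrow> complex ^ 'n" where "\<And>t. x t \<in> C" "\<And>t. (x has_vector_derivative F (x t)) (at t)" "x 0 = y" "x ?T = y"
      by (rule periodic_orbit_shift[OF C(1,2)]) blast
    then show ?thesis using C(3) by blast
  qed
  \<comment> \<open>Apply \<open>spec\<close> with \<open>k = 0\<close>: zero is not an
    eigenvalue.\<close>
  have ker: "u = 0" if "A *v u = 0" for u :: "complex ^ 'n"
    using eigenvalue_charpoly_root[of u A 0] spec[of 0] that by auto
  obtain i \<mu> \<eta> U h V and \<theta> :: "complex \<Rightarrow> complex ^ 'n"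
    where \<eta>: "\<eta> > 0" and \<theta>: "vholomorphic_on \<theta> (ball 0 \<eta>)" "\<theta> 0 = 0" "vderiv \<theta> 0 \<noteq> 0"
    "A *v vderiv \<theta> 0 = \<mu> *s vderiv \<theta> 0"
    and \<theta>eq: "\<And>u. u \<in> ball 0 \<eta> \<Longrightarrow> (\<mu> * u) *s vderiv \<theta> u = F (\<theta> u)"
    and U: "open U" "0 \<in> U" "D \<inter> U = \<theta> ` ball 0 \<eta>"
    and h: "open V" "h holomorphic_on V"
    and hV: "\<And>u. u \<in> ball 0 \<eta> \<Longrightarrow> \<theta> u $ i \<in> V" and hu: "\<And>u. u \<in> ball 0 \<eta> \<Longrightarrow> h (\<theta> u $ i) = u"
    and hF: "\<And>u. u \<in> ball 0 \<eta> \<Longrightarrow> deriv h (\<theta> u $ i) * (F (\<theta> u) $ i) = \<mu> * u"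
    by (rule linearized_disk[OF \<psi> D0 DR _ ker]) (use per in blast)+
  have "exp (\<mu> * of_real ?T) = 1"
    by (rule linearized_disk_exponent[OF \<eta> \<theta>(1,2) U(1,3) h hV hu hF T per])
  then obtain n :: int where "Re (\<mu> * of_real ?T) = 0" "Im (\<mu> * of_real ?T) = of_int (2 * n) * pi"
    unfolding exp_eq_1 by blast
  then have n: "Re \<mu> = 0" "Im \<mu> = of_int n * \<bar>\<omega>\<bar>" using w by (auto simp: field_simps)
  \<comment> \<open>\<open>n\<close> counts multiples of the absolute value of
    \<open>\<omega>\<close>; correcting the sign counts multiples of \<open>l\<close>.\<close>
  define m where "m = (if \<omega> > 0 then n else - n)"
  have \<mu>m: "\<mu> = of_int m * l" using n by (auto simp: complex_eq_iff m_def l)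
  then have "m = 1" using spec eigenvalue_charpoly_root[OF \<theta>(3,4)] by blast
  then have \<mu>: "\<mu> = l" using \<mu>m by simp
  obtain c where c: "vderiv \<theta> 0 = c *s v"
    by (rule simple_eigenspace[OF simple v_nonzero eigen]) (use \<theta>(4) \<mu> in auto)
  have c0: "c \<noteq> 0" using \<theta>(3) c by auto
  \<comment> \<open>On this radius both \<open>\<theta> u\<close> and \<open>f (c * u)\<close> have
    arguments inside their disks.\<close>
  define \<delta> where "\<delta> = min \<eta> (r / norm c)"
  have \<delta>: "\<delta> > 0" "\<delta> \<le> \<eta>" "\<delta> \<le> r / norm c" using \<eta> r c0 by (auto simp: \<delta>_def)
  have cb: "c * u \<in> ball 0 r" if "u \<in> ball 0 \<delta>" for u
  proof -
    have "norm c * norm u < norm c * \<delta>" using that c0 by simp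
    also have "\<dots> \<le> r" using \<delta>(3) c0 by (simp add: field_simps)
    finally show ?thesis by (simp add: norm_mult)
  qed
  have hf: "vholomorphic_on f (ball 0 r)" using emb by (simp add: holomorphic_disk_embedding_def vholomorphic_on_def)
  have hc: "(\<lambda>u. c * u) holomorphic_on ball 0 \<delta>" by (intro holomorphic_intros)
  have dc: "deriv (\<lambda>u. c * u) u = c" for u by (simp add: deriv_cmult_right)
  have "(\<lambda>u. c * u) ` ball 0 \<delta> \<subseteq> ball 0 r" using cb by blast
  note fc = vholomorphic_compose_scalar[OF hf open_ball hc open_ball this, unfolded dc]
  have B\<delta>: "ball 0 \<delta> \<subseteq> ball (0 :: complex) \<eta>" using \<delta>(2) by (rule subset_ball)
  have same: "\<theta> u = f (c * u)" if u: "u \<in> ball 0 \<delta>" for u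
  proof (rule invariant_disk_unique[where f = \<theta> and g = "\<lambda>u. f (c * u)", OF \<delta>(1) _ \<theta>(2) _ fc(1) _ _ _ u])
    show "vholomorphic_on \<theta> (ball 0 \<delta>)" using \<theta>(1) B\<delta> by (rule vholomorphic_on_subset)
    show "(l * z) *s vderiv \<theta> z = F (\<theta> z)" if "z \<in> ball 0 \<delta>" for z using \<theta>eq[of z] that B\<delta> \<mu> by auto
    show "f (c * 0) = 0" using f(1) by simp
    show "(l * z) *s vderiv (\<lambda>z. f (c * z)) z = F (f (c * z))" if "z \<in> ball 0 \<delta>" for z
      unfolding fc(2)[OF that] f(3)[OF cb[OF that], symmetric] by (simp add: vec_eq_iff)
    show "vderiv \<theta> 0 = vderiv (\<lambda>z. f (c * z)) 0"
      unfolding c using fc(2)[of 0] \<delta>(1) f(2) by simp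
  qed
  \<comment> \<open>Shrinking the parameter disk from \<open>\<eta>\<close> to
    \<open>\<delta>\<close> is again cut out by an open set, because \<open>h\<close> of coordinate
    \<open>i\<close> recovers the parameter.\<close>
  define U1 where "U1 = U \<inter> (\<lambda>x. x $ i) -` (V \<inter> h -` ball 0 \<delta>)"
  have oV: "open (V \<inter> h -` ball 0 \<delta>)"
    by (rule continuous_open_preimage[OF holomorphic_on_imp_continuous_on[OF h(2)] h(1) open_ball])
  have U1: "open U1" unfolding U1_def using U(1) open_vimage_vec_nth[OF oV] by (rule open_Int)
  have DU1: "D \<inter> U1 = \<theta> ` ball 0 \<delta>"
  proof -
    have "D \<inter> U1 = \<theta> ` ball 0 \<eta> \<inter> (\<lambda>x. x $ i) -` (V \<inter> h -` ball 0 \<delta>)" unfolding U1_def using U(3) by blast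
    also have "\<dots> = \<theta> ` ball 0 \<delta>" using hV hu B\<delta> by (auto simp: image_iff)
    finally show ?thesis .
  qed
  \<comment> \<open>The same piece seen in the parameter of \<open>f\<close>; as \<open>f\<close> is
    a homeomorphism onto its image, it too is cut out by an open set, \<open>U2\<close>.\<close>
  define S where "S = (\<lambda>u. c * u) ` ball 0 \<delta>"
  have oS: "open S" unfolding S_def
    by (rule open_mapping_thm3[OF hc open_ball]) (use c0 in \<open>auto simp: inj_on_def\<close>)
  have Sr: "S \<subseteq> ball 0 r" using cb by (auto simp: S_def)
  have \<theta>S: "\<theta> ` ball 0 \<delta> = f ` S" unfolding S_def image_image using same by (rule image_cong[OF refl])
  obtain \<sigma> where hom: "homeomorphism (ball 0 r) (f ` ball 0 r) f \<sigma>"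
    using emb by (auto simp: holomorphic_disk_embedding_def)
  have "openin (top_of_set (ball 0 r)) S" using oS Sr by (intro open_openin_trans) auto
  then have "openin (top_of_set (f ` ball 0 r)) (f ` S)" by (rule homeomorphism_imp_open_map[OF hom])
  then obtain U2 where U2: "open U2" "f ` S = f ` ball 0 r \<inter> U2" by (auto simp: openin_open)
  \<comment> \<open>The common piece lies in both open sets, so each disk meets
    \<open>U1 \<inter> U2\<close> in exactly this piece.\<close>
  have eq: "D \<inter> U1 = f ` ball 0 r \<inter> U2" using DU1 \<theta>S U2(2) by simp
  have "0 \<in> \<theta> ` ball 0 \<delta>" using \<theta>(2) \<delta>(1) by (metis centre_in_ball imageI)
  then have "0 \<in> U1 \<inter> U2" using DU1 eq by blast
  then show ?thesis
    unfolding coincide_near_0_def using U1 U2(1) eq by (intro exI[of _ "U1 \<inter> U2"]) blast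
qed

end

theorem theorem5:
  fixes F :: "complex ^ 'n \<Rightarrow> complex ^ 'n" and R \<omega> :: real
  assumes "R > 0"
    and "holomorphic_map_on F (ball 0 R)"
    and "F 0 = 0" and "\<forall>\<^sub>F x in at 0. F x \<noteq> 0"
    and "\<omega> \<noteq> 0"
    and "of_real \<omega> * \<i> \<in># eigenvalues (jacobian F (at 0))"
    and "\<forall>\<mu> \<in># (eigenvalues (jacobian F (at 0)) - {#of_real \<omega> * \<i>#}).
           \<mu> / (of_real \<omega> * \<i>) \<notin> \<int>"
  shows "\<exists>D. analytic_disk_in (ball 0 R) D \<and>
             consists_of_0_and_periodic_orbits F (ball 0 R) (2 * pi / \<bar>\<omega>\<bar>) D \<and>
             (\<forall>D'. analytic_disk_in (ball 0 R) D' \<and>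
                   consists_of_0_and_periodic_orbits F (ball 0 R) (2 * pi / \<bar>\<omega>\<bar>) D' \<longrightarrow>
                   coincide_near_0 D' D)"
proof -
  define l :: complex where "l = of_real \<omega> * \<i>"
  define A where "A = jacobian F (at 0)"
  have "0 \<in> ball (0 :: complex ^ 'n) R" using assms(1) by simp
  then obtain B where B: "(F has_derivative (*v) B) (at 0)"
    using holomorphic_map_derivative[OF assms(2) open_ball] by blast
  \<comment> \<open>\<open>jacobian\<close> is the matrix of the Frechet derivative; uniqueness of
    that derivative identifies it with the matrix supplied by
    \<open>holomorphic_map_on\<close>.\<close>
  have "A = B" unfolding A_def jacobian_def frechet_derivative_at[OF B, symmetric]
    by (rule matrix_of_matrix_vector_mul)
  with B have A: "(F has_derivative (*v) A) (at 0)" by simp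
  have l: "l \<noteq> 0" "l \<in># eigenvalues A" "\<forall>\<mu> \<in># (eigenvalues A - {#l#}). \<mu> / l \<notin> \<int>"
    using assms(5-7) by (auto simp: l_def A_def)
  note spec = nonresonant_spectrum[OF l]
  have "poly (charpoly A) l = 0" using l(2) spec(1) by (simp add: eigenvalues_def)
  then obtain v where v: "v \<noteq> 0" "A *v v = l *s v" by (rule eigenvector_exists)
  have "poly (charpoly A) (of_nat k * l) \<noteq> 0" if "k \<ge> 2" for k
    using spec(3)[of "int k"] that by auto
  then interpret nonresonant_field F R A l v
    using assms(1-3) A l(1) v by unfold_locales auto
  obtain f r where f: "r > 0" "holomorphic_disk_embedding f (ball 0 r)" "f ` ball 0 r \<subseteq> ball 0 R" "f 0 = 0"
    "vderiv f 0 = v" "\<And>z. z \<in> ball 0 r \<Longrightarrow> (l * z) *s vderiv f z = F (f z)"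
    by (rule embedded_invariant_disk) blast
  show ?thesis
  proof (intro exI[of _ "f ` ball 0 r"] conjI allI impI)
    show "analytic_disk_in (ball 0 R) (f ` ball 0 r)"
      using f(1-3) unfolding analytic_disk_in_def by blast
    show "consists_of_0_and_periodic_orbits F (ball 0 R) (2 * pi / \<bar>\<omega>\<bar>) (f ` ball 0 r)"
      by (rule disk_of_periodic_orbits[OF l_def f(2,1,3,4,6)])
    fix D' assume "analytic_disk_in (ball 0 R) D' \<and>
      consists_of_0_and_periodic_orbits F (ball 0 R) (2 * pi / \<bar>\<omega>\<bar>) D'"
    then show "coincide_near_0 D' (f ` ball 0 r)"
      by (intro periodic_disk_unique[OF l_def f(2,1,4-6) spec(3,1,2)]) auto
  qed
qed

end
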